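(* Let $n>3$, let $q$ be a power of a prime $p>3$, and let $\mathcal{S}:F(X_0,\dots,X_n)=0\subset\mathbb{P}^n$ be an absolutely irreducible hypersurface of degree $d>2$, where $F\in\mathbb{F}_q[X_0,\dots,X_n]$ is a homogeneous polynomial of the form $$F(X_0,\dots,X_n)=G(X_0,X_1,X_2)+a_3X_3^d+\cdots+a_nX_n^d,$$ with $a_i\ne 0$ for all $i=3,\dots,n$, and suppose that $p\nmid d$ and that $\sum_{i=0}^n\frac{\partial F}{\partial X_i}X_i^q$ is a nonzero polynomial. Let $\mathcal{V}_i$ denote the hyperplane $X_i=0$, and assume that $\mathcal{V}:=\mathcal{S}\cap\mathcal{V}_3\cap\cdots\cap\mathcal{V}_n\subset\mathcal{S}_{\operatorname{reg}}$. Then $\mathcal{S}$ is $\mathbb{F}_q$-Frobenius nonclassical if and only if there exist an integer $r>0$ such that $d=\frac{q-1}{p^r-1}$, and homogeneous polynomials $A(X_0,X_1,X_2),B(X_0,X_1,X_2),C(X_0,X_1,X_2)\in\mathbb{F}_q[X_0,X_1,X_2]$ of degree $(d-1)/p^r$ such that $$G(X_0,X_1,X_2)=A^{p^r}X_0+B^{p^r}X_1+C^{p^r}X_2=A\,X_0^{q/p^r}+B\,X_1^{q/p^r}+C\,X_2^{q/p^r}$$ and $a_i/a_n\in\mathbb{F}_{p^r}$ for all $i=3,\dots,n-1$.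
   Context: $\mathcal{S}_{\operatorname{reg}}$ is the nonsingular locus of $\mathcal{S}$. $\Phi_q$ is the $\mathbb{F}_q$-Frobenius map (raising coordinates to the $q$-th power). A hypersurface $\mathcal{S}$ over $\mathbb{F}_q$ defined by $F$ is $\mathbb{F}_q$-Frobenius nonclassical if $\Phi_q(P)\in T_P(\mathcal{S})$ (the tangent hyperplane) for every $P\in\mathcal{S}_{\operatorname{reg}}$; equivalently, if $F$ divides $\sum_i\frac{\partial F}{\partial X_i}X_i^q$.
   Formalization: The two identities are stated for G/a_n (the equation normalized so that X_n has coefficient 1) instead of G, since as printed the claim fails: c(X_0^6+...+X_4^6) with q=25, c in F_25 outside F_5, is Frobenius nonclassical but violates the identity. *)

theory Defs
  imports
    "HOL-Library.Poly_Mapping"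
    "HOL-Algebra.Algebraic_Closure_Type"
begin

text \<open>
  Polynomials in the variables \<open>X\<^sub>0, X\<^sub>1, X\<^sub>2, \<dots>\<close>: finitely supported functions from exponent
  vectors to coefficients. A polynomial in \<open>R[X\<^sub>0, \<dots>, X\<^sub>n]\<close> is one whose \<open>vars\<close> lie in \<open>{..n}\<close>.
\<close>

type_synonym 'a mpoly = "(nat \<Rightarrow>\<^sub>0 nat) \<Rightarrow>\<^sub>0 'a"

definition Var :: "nat \<Rightarrow> 'a::comm_ring_1 mpoly" where
  "Var i = Poly_Mapping.single (Poly_Mapping.single i 1) 1"

definition Const :: "'a::comm_ring_1 \<Rightarrow> 'a mpoly" where
  "Const c = Poly_Mapping.single 0 c"

definition vars :: "'a::zero mpoly \<Rightarrow> nat set" where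
  "vars F = (\<Union>m\<in>Poly_Mapping.keys F. Poly_Mapping.keys m)"

text \<open>As usual, the zero polynomial is homogeneous of every degree.\<close>

definition homogeneous :: "nat \<Rightarrow> 'a::zero mpoly \<Rightarrow> bool" where
  "homogeneous d F \<longleftrightarrow>
     (\<forall>m\<in>Poly_Mapping.keys F. (\<Sum>i\<in>Poly_Mapping.keys m. Poly_Mapping.lookup m i) = d)"

definition eval_mpoly :: "(nat \<Rightarrow> 'a::comm_ring_1) \<Rightarrow> 'a mpoly \<Rightarrow> 'a" where
  "eval_mpoly x F = (\<Sum>m\<in>Poly_Mapping.keys F.
     Poly_Mapping.lookup F m * (\<Prod>i\<in>Poly_Mapping.keys m. x i ^ Poly_Mapping.lookup m i))"

text \<open>
  Formal partial derivative. Monomials not involving \<open>X\<^sub>i\<close> contribute \<open>0\<close>, whatever the truncated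
  subtraction on exponents gives, because of the factor \<open>of_nat (lookup m i)\<close>.
\<close>

definition partial_deriv :: "nat \<Rightarrow> 'a::comm_ring_1 mpoly \<Rightarrow> 'a mpoly" where
  "partial_deriv i F = (\<Sum>m\<in>Poly_Mapping.keys F.
     Poly_Mapping.single (m - Poly_Mapping.single i 1)
       (of_nat (Poly_Mapping.lookup m i) * Poly_Mapping.lookup F m))"

definition base_change :: "'k::field mpoly \<Rightarrow> 'k alg_closure mpoly" where
  "base_change F = Poly_Mapping.map to_ac F"

text \<open>
  Irreducibility in the ring with infinitely many variables is the same as in the ring in the
  variables of \<open>F\<close>, since every factor of a nonzero \<open>F\<close> only involves variables of \<open>F\<close>.
\<close>

definition abs_irreducible :: "'k::field mpoly \<Rightarrow> bool" where
  "abs_irreducible F \<longleftrightarrow> Factorial_Ring.irreducible (base_change F)"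

text \<open>
  Points of projective \<open>n\<close>-space over the algebraic closure are given by homogeneous coordinate
  vectors \<open>(x 0, \<dots>, x n)\<close>, not all zero. Subsets of projective space are the corresponding
  scaling-invariant sets of coordinate vectors.
\<close>

definition proj_space :: "nat \<Rightarrow> (nat \<Rightarrow> 'a::field) set" where
  "proj_space n = {x. (\<exists>i\<le>n. x i \<noteq> 0) \<and> (\<forall>i>n. x i = 0)}"

definition hypersurface :: "nat \<Rightarrow> 'k::field mpoly \<Rightarrow> (nat \<Rightarrow> 'k alg_closure) set" where
  "hypersurface n F = {x \<in> proj_space n. eval_mpoly x (base_change F) = 0}"

definition regular_locus :: "nat \<Rightarrow> 'k::field mpoly \<Rightarrow> (nat \<Rightarrow> 'k alg_closure) set" where
  "regular_locus n F =
     {x \<in> hypersurface n F. \<exists>i\<le>n. eval_mpoly x (partial_deriv i (base_change F)) \<noteq> 0}"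

definition tangent_hyperplane ::
    "nat \<Rightarrow> 'k::field mpoly \<Rightarrow> (nat \<Rightarrow> 'k alg_closure) \<Rightarrow> (nat \<Rightarrow> 'k alg_closure) set" where
  "tangent_hyperplane n F x =
     {y \<in> proj_space n. (\<Sum>i\<le>n. eval_mpoly x (partial_deriv i (base_change F)) * y i) = 0}"

definition coord_hyperplane :: "nat \<Rightarrow> nat \<Rightarrow> (nat \<Rightarrow> 'a::field) set" where
  "coord_hyperplane n i = {x \<in> proj_space n. x i = 0}"

definition frob :: "nat \<Rightarrow> (nat \<Rightarrow> 'a::field) \<Rightarrow> (nat \<Rightarrow> 'a)" where
  "frob q x = (\<lambda>i. x i ^ q)"

definition frobenius_nonclassical :: "nat \<Rightarrow> nat \<Rightarrow> 'k::field mpoly \<Rightarrow> bool" where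
  "frobenius_nonclassical q n F \<longleftrightarrow>
     (\<forall>x\<in>regular_locus n F. frob q x \<in> tangent_hyperplane n F x)"

text \<open>
  \<open>in_GF Q x\<close> says \<open>x \<in> \<bbbF>\<^sub>Q\<close> for an element \<open>x\<close> of a finite field: \<open>\<bbbF>\<^sub>Q\<close> is the subfield with \<open>Q\<close>
  elements, of which a finite field contains at most one.
\<close>

definition in_GF :: "nat \<Rightarrow> 'k::finite_field \<Rightarrow> bool" where
  "in_GF Q x \<longleftrightarrow> (\<exists>K. subfield K (ring_of_type_algebra :: 'k ring) \<and> card K = Q \<and> x \<in> K)"

text \<open>
  On the normalization of the equation of the hypersurface. Being Frobenius nonclassical only
  depends on \<open>F\<close> up to a nonzero constant factor, whereas the identity
  \<open>G = A\<^bsup>Q\<^esup> X\<^sub>0 + B\<^bsup>Q\<^esup> X\<^sub>1 + C\<^bsup>Q\<^esup> X\<^sub>2 = A X\<^sub>0\<^bsup>q/Q\<^esup> + B X\<^sub>1\<^bsup>q/Q\<^esup> + C X\<^sub>2\<^bsup>q/Q\<^esup>\<close> is only invariant under factors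
  in \<open>\<bbbF>\<^sub>Q\<close>. It therefore has to be read for the equation scaled so that the coefficient of \<open>X\<^sub>n\<^bsup>d\<^esup>\<close>
  is \<open>1\<close>, that is, for \<open>G / a\<^sub>n\<close> in place of \<open>G\<close>; for \<open>a\<^sub>n \<in> \<bbbF>\<^sub>Q\<close> this makes no difference. Without
  the scaling, \<open>c (X\<^sub>0\<^bsup>6\<^esup> + \<dots> + X\<^sub>4\<^bsup>6\<^esup>)\<close> with \<open>c \<in> \<bbbF>\<^bsub>25\<^esub>\<close> outside \<open>\<bbbF>\<^sub>5\<close> is Frobenius nonclassical but
  violates the identity, and \<open>X\<^sub>0\<^bsup>6\<^esup> + X\<^sub>1\<^bsup>6\<^esup> + X\<^sub>2\<^bsup>6\<^esup> + c (X\<^sub>3\<^bsup>6\<^esup> + X\<^sub>4\<^bsup>6\<^esup>)\<close> satisfies it but is not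
  Frobenius nonclassical.
\<close>

end

theory Submission
  imports Defs
begin

text \<open>
  Put \<open>Q = p ^ r\<close>, \<open>g = G / a\<^sub>n\<close>, \<open>b\<^sub>i = a\<^sub>i / a\<^sub>n\<close>, and write \<open>G\<^sub>j\<close> and \<open>g\<^sub>j\<close> for partial derivatives.

  Suppose that the hypersurface is Frobenius nonclassical. Its equation can be solved for \<open>X\<^sub>n\<close>, and a
  point with \<open>X\<^sub>i \<noteq> 0\<close> for some \<open>i \<ge> 3\<close> is regular. Hence it suffices to look at points where only
  \<open>X\<^sub>0, X\<^sub>1, X\<^sub>2\<close>, one coordinate \<open>X\<^sub>i = t\<close> with \<open>3 \<le> i < n\<close>, and \<open>X\<^sub>n = y\<close> are nonzero
  (\<open>nonclassical_slice\<close>). With \<open>\<gamma>\<close> and \<open>w\<close> the values of \<open>G\<close> and \<open>G\<^sub>0 X\<^sub>0\<^sup>q + G\<^sub>1 X\<^sub>1\<^sup>q + G\<^sub>2 X\<^sub>2\<^sup>q\<close>, and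
  \<open>M = d - 1 + q\<close>, the condition becomes: if \<open>a\<^sub>n y\<^sup>d = -(\<gamma> + a\<^sub>i t\<^sup>d)\<close> then
  \<open>w + d (a\<^sub>i t\<^sup>M + a\<^sub>n y\<^sup>M) = 0\<close>. Three conclusions are drawn from this for fixed \<open>X\<^sub>0, X\<^sub>1, X\<^sub>2\<close>.
  Orders of vanishing at a simple root of \<open>\<gamma> + a\<^sub>i t\<^sup>d\<close> show that \<open>d\<close> divides \<open>M\<close>
  (\<open>dvd_exponent_if_binomial_relation\<close>). If \<open>M = d N\<close> and \<open>u = t\<^sup>d\<close>, then \<open>(\<gamma> + a\<^sub>i u)\<^sup>N\<close> can have no
  terms other than its constant and its leading one, which makes \<open>N = p\<^sup>r\<close> a power of \<open>p\<close>
  (\<open>prime_power_if_linear_power_relation\<close>); this is the formula \<open>d = (q - 1) / (p\<^sup>r - 1)\<close>. Finally,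
  comparing coefficients, \<open>b\<^sub>i\<^sup>Q = b\<^sub>i\<close>, and \<open>g\<^sub>0 X\<^sub>0\<^sup>q + g\<^sub>1 X\<^sub>1\<^sup>q + g\<^sub>2 X\<^sub>2\<^sup>q = d g\<^sup>Q = g\<^sup>Q\<close>, because
  \<open>d = 1\<close> in the field. The regularity of the plane section enters here through \<open>G \<noteq> 0\<close>.

  The identity for \<open>g\<close> determines its shape (\<open>frobenius_decomposition\<close>). The \<open>g\<^sub>j\<close> have degree
  \<open>d - 1 < q\<close>, so the three summands on the left have no monomials in common. Since \<open>g\<^sup>Q\<close> only
  involves \<open>Q\<close>-th powers, each \<open>g\<^sub>j\<close> is a \<open>Q\<close>-th power \<open>A\<^sub>j\<^sup>Q\<close>. Now Euler's identity gives
  \<open>g = \<Sum>\<^sub>j A\<^sub>j\<^sup>Q X\<^sub>j\<close>, and extracting \<open>Q\<close>-th roots gives \<open>g = \<Sum>\<^sub>j A\<^sub>j X\<^sub>j\<^bsup>q/Q\<^esup>\<close>.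

  Conversely, under these conditions \<open>\<Sum>\<^sub>i \<partial>F/\<partial>X\<^sub>i X\<^sub>i\<^sup>q = a\<^sub>n (F / a\<^sub>n)\<^sup>Q\<close>, which vanishes on the whole
  hypersurface (\<open>decomposition_imp_nonclassical\<close>).
\<close>


section \<open>Polynomials as sums of terms\<close>

lemma poly_mapping_sum_terms:
  "(\<Sum>m\<in>Poly_Mapping.keys F. Poly_Mapping.single m (Poly_Mapping.lookup F m)) = F"
  by (intro poly_mapping_eqI)
     (auto simp: lookup_sum lookup_single when_def not_in_keys_iff_lookup_eq_zero)

lemma mult_sum_terms:
  fixes F G :: "('a::comm_monoid_add) \<Rightarrow>\<^sub>0 ('b::comm_semiring_1)"
  shows "F * G = (\<Sum>m\<in>Poly_Mapping.keys F. \<Sum>l\<in>Poly_Mapping.keys G.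
    Poly_Mapping.single (m + l) (Poly_Mapping.lookup F m * Poly_Mapping.lookup G l))"
proof -
  have "F * G = (\<Sum>m\<in>Poly_Mapping.keys F. Poly_Mapping.single m (Poly_Mapping.lookup F m)) *
    (\<Sum>l\<in>Poly_Mapping.keys G. Poly_Mapping.single l (Poly_Mapping.lookup G l))"
    by (simp only: poly_mapping_sum_terms)
  then show ?thesis
    by (simp add: sum_product mult_single)
qed

lemma mult_single_sum_terms:
  fixes F :: "('a::comm_monoid_add) \<Rightarrow>\<^sub>0 ('b::comm_semiring_1)"
  shows "F * Poly_Mapping.single l c =
    (\<Sum>m\<in>Poly_Mapping.keys F. Poly_Mapping.single (m + l) (Poly_Mapping.lookup F m * c))"
proof -
  have "F * Poly_Mapping.single l c =
    (\<Sum>m\<in>Poly_Mapping.keys F. Poly_Mapping.single m (Poly_Mapping.lookup F m)) * Poly_Mapping.single l c"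
    by (simp only: poly_mapping_sum_terms)
  then show ?thesis
    by (simp add: sum_distrib_right mult_single)
qed

lemma lookup_mult_single:
  fixes F :: "('a::cancel_comm_monoid_add) \<Rightarrow>\<^sub>0 ('b::comm_semiring_1)"
  shows "Poly_Mapping.lookup (F * Poly_Mapping.single l c) (m + l) = Poly_Mapping.lookup F m * c"
  by (auto simp: mult_single_sum_terms lookup_sum lookup_single when_def
      not_in_keys_iff_lookup_eq_zero)

lemma lookup_mult_single_not_multiple:
  fixes F :: "('a::cancel_comm_monoid_add) \<Rightarrow>\<^sub>0 ('b::comm_semiring_1)"
  assumes "\<And>k. m \<noteq> k + l"
  shows "Poly_Mapping.lookup (F * Poly_Mapping.single l c) m = 0"
  unfolding mult_single_sum_terms lookup_sum
  by (intro sum.neutral ballI) (metis assms lookup_single_not_eq)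

lemma single_power:
  "Poly_Mapping.single m (c::'b::comm_ring_1) ^ k = Poly_Mapping.single (of_nat k * m) (c ^ k)"
  for m :: "nat \<Rightarrow>\<^sub>0 nat"
  by (induction k) (simp_all add: mult_single algebra_simps)

lemma lookup_of_nat_mult: "Poly_Mapping.lookup (of_nat k * m) i = k * Poly_Mapping.lookup m i"
  for m :: "nat \<Rightarrow>\<^sub>0 nat"
  by (induction k) (simp_all add: lookup_add algebra_simps)

lemma Var_power: "Var i ^ k = Poly_Mapping.single (Poly_Mapping.single i k) 1"
proof -
  have "of_nat k * Poly_Mapping.single i (1::nat) = Poly_Mapping.single i k"
    by (intro poly_mapping_eqI) (simp add: lookup_of_nat_mult lookup_single when_def)
  then show ?thesis by (simp add: Var_def single_power)
qed

lemma Const_mult_Var_power: "Const c * Var i ^ k = Poly_Mapping.single (Poly_Mapping.single i k) c"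
  by (simp add: Const_def Var_power mult_single)

lemma Const_mult: "Const (a * b) = Const a * Const b"
  and Const_1: "Const 1 = 1"
  and Const_0: "Const 0 = 0"
  by (simp_all add: Const_def mult_single)

lemma of_nat_mpoly: "(of_nat k :: 'a::comm_ring_1 mpoly) = Const (of_nat k)"
  by (simp add: Const_def)

lemma CHAR_mpoly: "CHAR('a::comm_ring_1 mpoly) = CHAR('a)"
proof (rule CHAR_eqI)
  show "of_nat CHAR('a) = (0 :: 'a mpoly)"
    unfolding of_nat_mpoly by (simp add: Const_0)
  fix x :: nat
  assume "of_nat x = (0 :: 'a mpoly)"
  then have "Poly_Mapping.single (0 :: nat \<Rightarrow>\<^sub>0 nat) (of_nat x :: 'a) = 0"
    unfolding of_nat_mpoly Const_def .
  then have "of_nat x = (0 :: 'a)"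
    by (metis lookup_single_eq lookup_zero)
  then show "CHAR('a) dvd x"
    by (simp add: of_nat_eq_0_iff_char_dvd)
qed


section \<open>Evaluation, base change and derivatives\<close>

text \<open>
  Every map on polynomials that is additive, such as evaluation, base change or a derivative, is
  determined by its values on single terms. Multiplicativity and compatibility statements are
  therefore reduced to terms by the expansions of the previous section.
\<close>

definition eval_monom :: "(nat \<Rightarrow> 'a::comm_ring_1) \<Rightarrow> (nat \<Rightarrow>\<^sub>0 nat) \<Rightarrow> 'a" where
  "eval_monom x m = (\<Prod>i\<in>Poly_Mapping.keys m. x i ^ Poly_Mapping.lookup m i)"

lemma eval_monom_superset:
  assumes "finite S" "Poly_Mapping.keys m \<subseteq> S"
  shows "eval_monom x m = (\<Prod>i\<in>S. x i ^ Poly_Mapping.lookup m i)"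
  unfolding eval_monom_def
  by (intro prod.mono_neutral_left) (use assms in \<open>auto simp: in_keys_iff\<close>)

lemma eval_monom_add: "eval_monom x (m + l) = eval_monom x m * eval_monom x l"
proof -
  let ?S = "Poly_Mapping.keys m \<union> Poly_Mapping.keys l"
  have "Poly_Mapping.keys (m + l) \<subseteq> ?S" by (rule keys_add)
  then show ?thesis
    by (simp add: eval_monom_superset[of ?S] lookup_add power_add prod.distrib)
qed

lemma eval_mpoly_alt:
  "eval_mpoly x F = (\<Sum>m\<in>Poly_Mapping.keys F. Poly_Mapping.lookup F m * eval_monom x m)"
  by (simp add: eval_mpoly_def eval_monom_def)

lemma eval_mpoly_single: "eval_mpoly x (Poly_Mapping.single m c) = c * eval_monom x m"
  by (simp add: eval_mpoly_alt)

lemma eval_mpoly_add: "eval_mpoly x (F + G) = eval_mpoly x F + eval_mpoly x G"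
  unfolding eval_mpoly_alt by (rule setsum_keys_plus_distrib) (simp_all add: algebra_simps)

lemma eval_mpoly_0: "eval_mpoly x 0 = 0"
  by (simp add: eval_mpoly_alt)

lemma eval_mpoly_sum: "eval_mpoly x (\<Sum>i\<in>I. f i) = (\<Sum>i\<in>I. eval_mpoly x (f i))"
  by (induction I rule: infinite_finite_induct) (simp_all add: eval_mpoly_0 eval_mpoly_add)

lemma eval_mpoly_mult: "eval_mpoly x (F * G) = eval_mpoly x F * eval_mpoly x G"
  unfolding mult_sum_terms[of F G]
  by (simp add: eval_mpoly_sum eval_mpoly_single eval_monom_add)
     (simp add: eval_mpoly_alt sum_product algebra_simps)

lemma lookup_base_change: "Poly_Mapping.lookup (base_change F) m = to_ac (Poly_Mapping.lookup F m)"
  by (simp add: base_change_def map.rep_eq when_def)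

lemma keys_base_change: "Poly_Mapping.keys (base_change F) = Poly_Mapping.keys F"
  by (auto simp: in_keys_iff lookup_base_change)

lemma base_change_single: "base_change (Poly_Mapping.single m c) = Poly_Mapping.single m (to_ac c)"
  by (intro poly_mapping_eqI) (simp add: lookup_base_change lookup_single when_def)

lemma base_change_add: "base_change (F + G) = base_change F + base_change G"
  by (intro poly_mapping_eqI) (simp add: lookup_base_change lookup_add)

lemma base_change_0: "base_change 0 = 0"
  by (intro poly_mapping_eqI) (simp add: lookup_base_change)

lemma base_change_sum: "base_change (\<Sum>i\<in>I. f i) = (\<Sum>i\<in>I. base_change (f i))"
  by (induction I rule: infinite_finite_induct) (simp_all add: base_change_0 base_change_add)

lemma base_change_mult: "base_change (F * G) = base_change F * base_change G"
  unfolding mult_sum_terms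
  by (simp add: base_change_sum base_change_single keys_base_change lookup_base_change)

definition eval_ac :: "(nat \<Rightarrow> 'k::field alg_closure) \<Rightarrow> 'k mpoly \<Rightarrow> 'k alg_closure" where
  "eval_ac x F = eval_mpoly x (base_change F)"

lemma eval_ac_add: "eval_ac x (F + G) = eval_ac x F + eval_ac x G"
  and eval_ac_mult: "eval_ac x (F * G) = eval_ac x F * eval_ac x G"
  and eval_ac_0: "eval_ac x 0 = 0"
  and eval_ac_sum: "eval_ac x (\<Sum>i\<in>I. f i) = (\<Sum>i\<in>I. eval_ac x (f i))"
  and eval_ac_Const: "eval_ac x (Const c) = to_ac c"
  and eval_ac_Var: "eval_ac x (Var i) = x i"
  by (simp_all add: eval_ac_def base_change_add base_change_mult base_change_0 base_change_sum
      eval_mpoly_add eval_mpoly_mult eval_mpoly_0 eval_mpoly_sum Const_def Var_def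
      base_change_single eval_mpoly_single eval_monom_def)

lemma eval_ac_1: "eval_ac x 1 = 1"
  using eval_ac_Const[of x 1] by (simp add: Const_1)

lemma eval_ac_power: "eval_ac x (F ^ k) = eval_ac x F ^ k"
  by (induction k) (simp_all add: eval_ac_1 eval_ac_mult)

lemma eval_ac_diff: "eval_ac x (F - G) = eval_ac x F - eval_ac x G"
  using eval_ac_add[of x "F - G" G] by (simp add: eq_diff_eq)

lemmas eval_ac_simps = eval_ac_add eval_ac_mult eval_ac_0 eval_ac_1 eval_ac_sum eval_ac_Const
  eval_ac_Var eval_ac_power

lemma eval_ac_cong:
  assumes "\<And>i. i \<in> vars F \<Longrightarrow> x i = y i"
  shows "eval_ac x F = eval_ac y F"
proof -
  have "eval_monom x m = eval_monom y m" if "m \<in> Poly_Mapping.keys F" for m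
    unfolding eval_monom_def by (intro prod.cong refl) (metis UN_I assms that vars_def)
  then show ?thesis
    by (simp add: eval_ac_def eval_mpoly_alt keys_base_change)
qed

lemma partial_deriv_single:
  "partial_deriv i (Poly_Mapping.single m c) =
     Poly_Mapping.single (m - Poly_Mapping.single i 1) (of_nat (Poly_Mapping.lookup m i) * c)"
  by (simp add: partial_deriv_def)

lemma partial_deriv_0: "partial_deriv i 0 = 0"
  by (simp add: partial_deriv_def)

lemma partial_deriv_add: "partial_deriv i (F + G) = partial_deriv i F + partial_deriv i G"
  unfolding partial_deriv_def
  by (rule setsum_keys_plus_distrib) (simp_all add: algebra_simps single_add)

lemma partial_deriv_sum: "partial_deriv i (\<Sum>j\<in>I. f j) = (\<Sum>j\<in>I. partial_deriv i (f j))"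
  by (induction I rule: infinite_finite_induct) (simp_all add: partial_deriv_0 partial_deriv_add)

lemma partial_deriv_base_change: "partial_deriv i (base_change F) = base_change (partial_deriv i F)"
  by (simp add: partial_deriv_def base_change_sum base_change_single keys_base_change
      lookup_base_change)

lemma partial_deriv_Const_mult: "partial_deriv i (Const c * F) = Const c * partial_deriv i F"
proof -
  have "Const c * F = (\<Sum>m\<in>Poly_Mapping.keys F. Const c * Poly_Mapping.single m (Poly_Mapping.lookup F m))"
    by (simp add: poly_mapping_sum_terms flip: sum_distrib_left)
  also have "partial_deriv i \<dots> = Const c * partial_deriv i F"
    by (simp add: partial_deriv_sum Const_def mult_single partial_deriv_single)
       (simp add: partial_deriv_def sum_distrib_left mult_single algebra_simps)
  finally show ?thesis .
qed

text \<open>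
  The exponent \<open>k - 1\<close> is truncated, but for \<open>k = 0\<close> the coefficient vanishes.
\<close>

lemma partial_deriv_Const_mult_Var_power:
  "partial_deriv j (Const c * Var i ^ k) =
     (if j = i then Const (of_nat k * c) * Var i ^ (k - 1) else 0)"
  by (simp add: Const_mult_Var_power partial_deriv_single lookup_single when_def
      flip: single_diff)

lemma partial_deriv_not_in_vars:
  assumes "i \<notin> vars F"
  shows "partial_deriv i F = 0"
  using assms by (auto simp: partial_deriv_def vars_def in_keys_iff intro!: sum.neutral)

section \<open>Vanishing polynomial functions\<close>

lemma base_digits_less:
  fixes B :: nat
  assumes "\<And>i. i < N \<Longrightarrow> e i < B"
  shows "(\<Sum>i<N. e i * B ^ i) < B ^ N"
  using assms
proof (induction N)
  case (Suc N)
  have "(\<Sum>i<Suc N. e i * B ^ i) < B ^ N + e N * B ^ N"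
    using Suc by simp
  also have "\<dots> = Suc (e N) * B ^ N"
    by simp
  also have "\<dots> \<le> B * B ^ N"
    using Suc.prems[of N] by (intro mult_right_mono) auto
  finally show ?case by simp
qed simp

text \<open>
  The leading digit is the quotient by \<open>B ^ N\<close>, since the lower digits contribute less than \<open>B ^ N\<close>.
\<close>

lemma base_digits_unique:
  fixes B :: nat
  assumes "\<And>i. i < N \<Longrightarrow> e i < B" "\<And>i. i < N \<Longrightarrow> e' i < B"
  assumes "(\<Sum>i<N. e i * B ^ i) = (\<Sum>i<N. e' i * B ^ i)"
  assumes "i < N"
  shows "e i = e' i"
  using assms
proof (induction N)
  case (Suc N)
  let ?S = "\<Sum>i<N. e i * B ^ i" and ?S' = "\<Sum>i<N. e' i * B ^ i"
  have lt: "?S < B ^ N" "?S' < B ^ N"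
    using Suc.prems by (auto intro!: base_digits_less)
  have eq: "?S + e N * B ^ N = ?S' + e' N * B ^ N"
    using Suc.prems(3) by simp
  have nz: "B ^ N \<noteq> 0"
    using lt by linarith
  have "e N = (?S + e N * B ^ N) div B ^ N"
    using lt by (simp add: div_mult_self1[OF nz])
  also have "\<dots> = e' N"
    unfolding eq using lt by (simp add: div_mult_self1[OF nz])
  finally have "e N = e' N" .
  with eq Suc show ?case
    by (cases "i = N") auto
qed simp

lemma finite_vars: "finite (vars F)"
  by (simp add: vars_def)

lemma poly_eqI_infinite:
  fixes P R :: "'a::idom poly"
  assumes "infinite S" "\<And>x. x \<in> S \<Longrightarrow> poly P x = poly R x"
  shows "P = R"
proof (rule ccontr)
  assume "P \<noteq> R"
  then have "finite {x. poly (P - R) x = 0}"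
    by (intro poly_roots_finite) simp
  moreover have "S \<subseteq> {x. poly (P - R) x = 0}"
    using assms(2) by auto
  ultimately show False
    using assms(1) finite_subset by blast
qed

text \<open>
  Kronecker substitution: for \<open>B\<close> larger than all exponents, \<open>X\<^sub>i \<mapsto> t\<^bsup>B^i\<^esup>\<close> sends distinct monomials
  to distinct powers of \<open>t\<close>, because the exponent of the image is the number whose digits in base \<open>B\<close>
  are the exponents of the monomial. The statement is thereby reduced to univariate polynomials.
\<close>

lemma mpoly_eq_0_if_vanishing:
  fixes F :: "'a::field mpoly"
  assumes "infinite (UNIV :: 'a set)" and vanish: "\<And>x. eval_mpoly x F = 0"
  shows "F = 0"
proof -
  obtain N where N: "vars F \<subseteq> {..<N}"
    using finite_nat_iff_bounded finite_vars by blast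
  define E where "E = (\<Union>m\<in>Poly_Mapping.keys F. Poly_Mapping.lookup m ` Poly_Mapping.keys m)"
  have "finite E"
    by (simp add: E_def)
  then obtain B where "E \<subseteq> {..<B}"
    using finite_nat_iff_bounded by blast
  then have B: "Poly_Mapping.lookup m i < Suc B" if "m \<in> Poly_Mapping.keys F" for m i
  proof (cases "i \<in> Poly_Mapping.keys m")
    case True
    then have "Poly_Mapping.lookup m i \<in> E"
      using that by (auto simp: E_def)
    then show ?thesis
      using \<open>E \<subseteq> {..<B}\<close> by auto
  qed (simp add: not_in_keys_iff_lookup_eq_zero)
  define code where "code = (\<lambda>m. \<Sum>i<N. Poly_Mapping.lookup m i * Suc B ^ i)"
  have keys: "Poly_Mapping.keys m \<subseteq> {..<N}" if "m \<in> Poly_Mapping.keys F" for m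
    using N that by (auto simp: vars_def)
  have inj: "inj_on code (Poly_Mapping.keys F)"
  proof (intro inj_onI poly_mapping_eqI)
    fix m l i
    assume ml: "m \<in> Poly_Mapping.keys F" "l \<in> Poly_Mapping.keys F" "code m = code l"
    show "Poly_Mapping.lookup m i = Poly_Mapping.lookup l i"
    proof (cases "i < N")
      case True
      then show ?thesis
        using base_digits_unique[of N "Poly_Mapping.lookup m" "Suc B" "Poly_Mapping.lookup l" i] ml B
        by (simp add: code_def)
    next
      case False
      then show ?thesis
        using keys ml(1,2) by (metis in_keys_iff lessThan_iff subset_iff)
    qed
  qed
  define P where "P = (\<Sum>m\<in>Poly_Mapping.keys F. monom (Poly_Mapping.lookup F m) (code m))"
  have "poly P t = eval_mpoly (\<lambda>i. t ^ (Suc B ^ i)) F" for t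
  proof -
    have "eval_monom (\<lambda>i. t ^ (Suc B ^ i)) m = t ^ code m" if "m \<in> Poly_Mapping.keys F" for m
      unfolding eval_monom_superset[OF finite_lessThan keys[OF that]] code_def power_sum
      by (intro prod.cong refl) (simp add: mult.commute flip: power_mult)
    then show ?thesis
      by (simp add: P_def poly_sum poly_monom eval_mpoly_alt)
  qed
  then have "P = 0"
    using vanish by (intro poly_eqI_infinite[OF assms(1)]) simp
  have "Poly_Mapping.lookup F m = 0" if "m \<in> Poly_Mapping.keys F" for m
  proof -
    have "Polynomial.coeff P (code m) =
        (\<Sum>l\<in>Poly_Mapping.keys F. if l = m then Poly_Mapping.lookup F l else 0)"
      unfolding P_def coeff_sum coeff_monom
      using inj that by (intro sum.cong refl) (auto dest: inj_onD)
    then show ?thesis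
      using that \<open>P = 0\<close> by simp
  qed
  then show ?thesis
    by (intro poly_mapping_eqI) (metis in_keys_iff lookup_zero)
qed

text \<open>
  The polynomial \<open>1 + \<Prod>\<^sub>a (X - a)\<close> over a finite field has no root in it.
\<close>

lemma infinite_UNIV_alg_closed: "infinite (UNIV :: 'a::alg_closed_field set)"
proof
  assume fin: "finite (UNIV :: 'a set)"
  define P where "P = (\<Prod>a\<in>(UNIV :: 'a set). [:- a, 1:])"
  have "Polynomial.degree P = card (UNIV :: 'a set)"
    unfolding P_def by (subst degree_prod_sum_eq) auto
  then have "Polynomial.degree P > 0"
    using fin by (simp add: finite_UNIV_card_ge_0)
  then have "Polynomial.degree (P + 1) > 0"
    by (subst degree_add_eq_left) auto
  then obtain x where "poly (P + 1) x = 0"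
    using alg_closed_imp_poly_has_root by blast
  moreover have "poly P x = 0"
    unfolding P_def poly_prod using fin by (intro prod_zero) auto
  ultimately show False by simp
qed

lemma eq_0_if_eval_ac_vanishing:
  assumes "\<And>x. eval_ac x F = 0"
  shows "F = 0"
proof -
  have "base_change F = 0"
    using assms by (intro mpoly_eq_0_if_vanishing infinite_UNIV_alg_closed) (simp add: eval_ac_def)
  then show ?thesis
    by (metis keys_base_change keys_eq_empty)
qed


section \<open>Powers on affine lines\<close>

lemma order_power:
  fixes P :: "'a::idom poly"
  assumes "P \<noteq> 0"
  shows "Polynomial.order x (P ^ k) = k * Polynomial.order x P"
  using assms by (induction k) (simp_all add: order_mult)

text \<open>
  Raising the second equation to the power \<open>d\<close> and the first to the power \<open>M\<close> eliminates \<open>y\<close> and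
  leaves a polynomial identity \<open>Z ^ d = E ^ M\<close> in \<open>t\<close>, where \<open>E = -(\<gamma> + b t\<^sup>d) / c\<close> is the value of
  \<open>y ^ d\<close>. Since \<open>d\<close> is invertible and \<open>\<gamma> \<noteq> 0\<close>, all roots of \<open>E\<close> are simple. At such a root the right
  hand side has order \<open>M\<close>, and the order of the left hand side is a multiple of \<open>d\<close>.
\<close>

lemma dvd_exponent_if_binomial_relation:
  fixes \<gamma> b c e w :: "'a::alg_closed_field"
  assumes nz: "\<gamma> \<noteq> 0" "b \<noteq> 0" "c \<noteq> 0" "e \<noteq> 0" "of_nat d \<noteq> (0::'a)"
  assumes "M > 0"
  assumes rel: "\<And>t y. t \<noteq> 0 \<Longrightarrow> c * y ^ d = - (\<gamma> + b * t ^ d) \<Longrightarrow> w + e * (b * t ^ M + c * y ^ M) = 0"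
  shows "d dvd M"
proof -
  have d: "d > 0" using nz(5) by (intro Nat.gr0I) auto
  define Z where "Z = smult (1 / c) ([:- w / e:] - monom b M)"
  define E where "E = smult (- 1 / c) ([:\<gamma>:] + monom b d)"
  have "Z ^ d = E ^ M"
  proof (rule poly_eqI_infinite)
    show "infinite (UNIV - {0 :: 'a})"
      by (simp add: infinite_UNIV_alg_closed)
    fix t :: 'a
    assume "t \<in> UNIV - {0}"
    obtain y where y: "y ^ d = poly E t"
      using nth_root_exists[OF d] by blast
    then have "c * y ^ d = - (\<gamma> + b * t ^ d)"
      using nz by (simp add: E_def poly_monom)
    then have "w + e * (b * t ^ M + c * y ^ M) = 0"
      using rel \<open>t \<in> _\<close> by simp
    then have "(b * t ^ M + c * y ^ M) * e = - w"
      by (simp add: eq_neg_iff_add_eq_0 add.commute mult.commute)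
    then have "b * t ^ M + c * y ^ M = - w / e"
      using nz(4) by (metis nonzero_eq_divide_eq)
    then have "c * y ^ M = - w / e - b * t ^ M"
      by (simp add: eq_diff_eq add.commute)
    then have "poly Z t = y ^ M"
      using nz by (simp add: Z_def poly_monom field_simps)
    then show "poly (Z ^ d) t = poly (E ^ M) t"
      unfolding poly_power y[symmetric] by (metis mult.commute power_mult)
  qed
  obtain t where t: "t ^ d = - \<gamma> / b"
    using nth_root_exists[OF d] by blast
  then have "t \<noteq> 0"
    using nz d by (auto simp: power_0_left)
  have root: "poly E t = 0"
    using t nz by (simp add: E_def poly_monom)
  have deriv: "poly (pderiv E) t \<noteq> 0"
    using nz \<open>t \<noteq> 0\<close> by (simp add: E_def pderiv_minus pderiv_smult pderiv_add pderiv_monom poly_monom pderiv_pCons)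
  then have "E \<noteq> 0" by auto
  \<comment> \<open>a double root would also be a root of the derivative\<close>
  have "Polynomial.order t E = 1"
  proof (rule ccontr)
    assume "Polynomial.order t E \<noteq> 1"
    moreover have "Polynomial.order t E > 0"
      using root \<open>E \<noteq> 0\<close> by (simp add: order_gt_0_iff)
    ultimately have "[:- t, 1:] ^ 2 dvd E"
      by (subst order_divides) auto
    then obtain R where R: "E = [:- t, 1:] ^ 2 * R"
      by blast
    have "poly [:- t, 1:] t = 0"
      by simp
    then have "poly (pderiv E) t = 0"
      unfolding R power2_eq_square pderiv_mult poly_add poly_mult by (simp only: mult_zero_left
          mult_zero_right add_0)
    with deriv show False by simp
  qed
  then have "Polynomial.order t (E ^ M) = M"
    using \<open>E \<noteq> 0\<close> by (simp add: order_power)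
  moreover have "Z \<noteq> 0"
    using \<open>Z ^ d = E ^ M\<close> \<open>E \<noteq> 0\<close> d by (metis power_eq_0_iff)
  then have "Polynomial.order t (Z ^ d) = d * Polynomial.order t Z"
    by (simp add: order_power)
  ultimately show ?thesis
    using \<open>Z ^ d = E ^ M\<close> by (metis dvd_triv_left)
qed

text \<open>
  The relation says that \<open>(\<gamma> + b u) ^ N\<close> has no terms besides the constant and the leading one.
  To see that this forces \<open>N\<close> to be a power of the characteristic, write \<open>N = P m\<close> with \<open>P\<close> a power
  of \<open>p\<close> and \<open>m\<close> prime to \<open>p\<close>. As the \<open>P\<close>-th power map is additive and surjective, the relation
  becomes \<open>w + e (b v\<^sup>m + c (\<alpha> + \<beta> v)\<^sup>m) = 0\<close> for all \<open>v = u\<^sup>P\<close>, and for \<open>m > 1\<close> the coefficient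
  \<open>e c m \<alpha>\<^bsup>m-1\<^esup> \<beta>\<close> of \<open>v\<close> does not vanish.
\<close>

lemma prime_power_if_linear_power_relation:
  fixes \<gamma> b c e w :: "'a::alg_closed_field"
  assumes nz: "\<gamma> \<noteq> 0" "b \<noteq> 0" "c \<noteq> 0" "e \<noteq> 0"
  assumes p: "prime p" "CHAR('a) = p" and "N > 0"
  assumes rel: "\<And>u. u \<noteq> 0 \<Longrightarrow> w + e * (b * u ^ N + c * (- (\<gamma> + b * u) / c) ^ N) = 0"
  shows "\<exists>r. N = p ^ r"
proof -
  obtain m where N: "N = p ^ multiplicity p N * m" and "\<not> p dvd m"
    using multiplicity_decompose'[of N p] p \<open>N > 0\<close> by (metis not_prime_unit not_less0)
  define P where "P = p ^ multiplicity p N"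
  have NP: "N = P * m"
    using N unfolding P_def .
  have "P > 0" using p by (simp add: P_def prime_gt_0_nat)
  define \<alpha> \<beta> where "\<alpha> = (- \<gamma> / c) ^ P" and "\<beta> = (- b / c) ^ P"
  have \<alpha>\<beta>: "\<alpha> \<noteq> 0" "\<beta> \<noteq> 0"
    using nz by (simp_all add: \<alpha>_def \<beta>_def)
  define R where "R = [:w:] + smult e (monom b m + smult c ([:\<alpha>, \<beta>:] ^ m))"
  have "R = 0"
  proof (rule poly_eqI_infinite)
    show "infinite (UNIV - {0 :: 'a})"
      by (simp add: infinite_UNIV_alg_closed)
    fix v :: 'a
    assume "v \<in> UNIV - {0}"
    obtain u where u: "u ^ P = v"
      using nth_root_exists[OF \<open>P > 0\<close>] by blast
    then have "u \<noteq> 0"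
      using \<open>v \<in> _\<close> \<open>P > 0\<close> by (auto simp: power_0_left)
    have "- (\<gamma> + b * u) / c = - \<gamma> / c + - b / c * u"
      by (simp add: diff_divide_distrib)
    then have "(- (\<gamma> + b * u) / c) ^ P = (- \<gamma> / c + - b / c * u) ^ P"
      by simp
    also have "\<dots> = \<alpha> + (- b / c * u) ^ P"
      unfolding \<alpha>_def using p by (intro freshmans_dream') (auto simp: P_def)
    also have "\<dots> = \<alpha> + v * \<beta>"
      unfolding power_mult_distrib u \<beta>_def by simp
    finally have "(- (\<gamma> + b * u) / c) ^ N = (\<alpha> + v * \<beta>) ^ m"
      unfolding NP by (simp add: power_mult)
    moreover have "u ^ N = v ^ m"
      unfolding NP by (simp add: power_mult u)
    ultimately show "poly R v = poly 0 v"
      using rel[OF \<open>u \<noteq> 0\<close>] by (simp add: R_def poly_monom)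
  qed
  have "m \<noteq> 0" using NP \<open>N > 0\<close> by (intro notI) simp
  have "of_nat m \<noteq> (0::'a)"
    using p \<open>\<not> p dvd m\<close> by (simp add: of_nat_eq_0_iff_char_dvd)
  have "m = 1"
  proof (rule ccontr)
    assume "m \<noteq> 1"
    with \<open>m \<noteq> 0\<close> have "m - 1 > 0" by simp
    have "poly (pderiv R) 0 = e * (c * (of_nat m * (\<alpha> ^ (m - 1) * \<beta>)))"
      using \<open>m - 1 > 0\<close>
      by (simp add: R_def pderiv_add pderiv_smult pderiv_monom poly_monom pderiv_power pderiv_pCons
          power_0_left mult_ac)
    with \<open>R = 0\<close> \<alpha>\<beta> nz \<open>of_nat m \<noteq> 0\<close> show False by simp
  qed
  with N show ?thesis by auto
qed

text \<open>
  By additivity of the Frobenius power, the relation is linear in \<open>u ^ (p ^ r)\<close>, and it can be solved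
  for its two coefficients by evaluating at \<open>u = 1\<close> and \<open>u = -1\<close>.
\<close>

lemma frobenius_relation_coefficients:
  fixes \<gamma> b c e w :: "'a::field"
  assumes nz: "c \<noteq> 0" "e \<noteq> 0"
  assumes p: "prime p" "CHAR('a) = p" "p \<noteq> 2"
  assumes rel: "\<And>u. u \<noteq> 0 \<Longrightarrow>
      w + e * (b * u ^ (p ^ r) + c * (- (\<gamma> + b * u) / c) ^ (p ^ r)) = 0"
  shows "w = e * c * (\<gamma> / c) ^ (p ^ r)" "(b / c) ^ (p ^ r) = b / c"
proof -
  have odd: "odd (p ^ r)"
    using p prime_odd_nat[of p] prime_ge_2_nat[of p] by auto
  have two: "(2::'a) \<noteq> 0"
    using of_nat_eq_0_iff_char_dvd[where ?'a = 'a, of 2] p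
    by (metis of_nat_numeral prime_nat_iff two_is_prime_nat primes_dvd_imp_eq)
  have frob: "(\<gamma> / c + b / c * u) ^ (p ^ r) = (\<gamma> / c) ^ (p ^ r) + (b / c) ^ (p ^ r) * u ^ (p ^ r)" for u
    using freshmans_dream'[of "p ^ r" r "\<gamma> / c" "b / c * u"] p
    unfolding power_mult_distrib by simp
  have *: "w + e * (b * u ^ (p ^ r) - c * ((\<gamma> / c) ^ (p ^ r) + (b / c) ^ (p ^ r) * u ^ (p ^ r))) = 0"
    if "u \<noteq> 0" for u
  proof -
    have "- (\<gamma> + b * u) / c = - (\<gamma> / c + b / c * u)"
      using nz by (simp add: field_simps)
    then have eq: "(- (\<gamma> + b * u) / c) ^ (p ^ r) =
        - ((\<gamma> / c) ^ (p ^ r) + (b / c) ^ (p ^ r) * u ^ (p ^ r))"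
      by (simp only: power_minus_odd[OF odd] frob)
    show ?thesis
      using rel[OF that] unfolding eq by (simp only: mult_minus_right diff_conv_add_uminus)
  qed
  have 1: "w + e * (b - c * ((\<gamma> / c) ^ (p ^ r) + (b / c) ^ (p ^ r))) = 0"
    using *[of 1] by simp
  have 2: "w + e * (- b - c * ((\<gamma> / c) ^ (p ^ r) - (b / c) ^ (p ^ r))) = 0"
    using *[of "- 1"] odd by simp
  have "2 * (w - e * c * (\<gamma> / c) ^ (p ^ r)) =
      (w + e * (b - c * ((\<gamma> / c) ^ (p ^ r) + (b / c) ^ (p ^ r)))) +
      (w + e * (- b - c * ((\<gamma> / c) ^ (p ^ r) - (b / c) ^ (p ^ r))))"
    by (simp add: algebra_simps)
  also have "\<dots> = 0"
    by (simp only: 1 2 add_0)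
  finally show w: "w = e * c * (\<gamma> / c) ^ (p ^ r)"
    using two by simp
  have "e * (b - c * (b / c) ^ (p ^ r)) =
      w + e * (b - c * ((\<gamma> / c) ^ (p ^ r) + (b / c) ^ (p ^ r)))"
    unfolding w by (simp add: algebra_simps)
  also have "\<dots> = 0"
    by (rule 1)
  finally have "c * (b / c) ^ (p ^ r) = b"
    using nz(2) by simp
  then show "(b / c) ^ (p ^ r) = b / c"
    using nz(1) by (metis nonzero_mult_div_cancel_left)
qed

section \<open>Finite fields\<close>

text \<open>
  Translation by \<open>1\<close> permutes the elements of the ring, so it does not change their sum.
\<close>

lemma of_nat_card_UNIV: "of_nat (card (UNIV :: 'a::{finite,ring_1} set)) = (0 :: 'a)"
proof -
  have "(\<Sum>x\<in>(UNIV::'a set). x + 1) = \<Sum>UNIV"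
    by (rule sum.reindex_bij_witness[of _ "\<lambda>x. x - 1" "\<lambda>x. x + 1"]) auto
  then show ?thesis
    by (simp add: sum.distrib)
qed

lemma CHAR_eq_if_card_prime_power:
  assumes "prime p" "card (UNIV :: 'k::finite_field set) = p ^ s"
  shows "CHAR('k) = p"
proof -
  have "of_nat (p ^ s) = (0 :: 'k)"
    using of_nat_card_UNIV[where ?'a = 'k] assms(2) by simp
  then have "CHAR('k) dvd p ^ s"
    by (simp only: of_nat_eq_0_iff_char_dvd)
  then show ?thesis
    using assms(1) CHAR_prime[where ?'a = 'k] by (metis prime_dvd_power primes_dvd_imp_eq)
qed

lemma card_power_fiber_le:
  fixes y :: "'a::field"
  assumes "k > 0"
  shows "card {x. x ^ k = y} \<le> k"
proof -
  let ?P = "monom 1 k + [:- y:]"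
  have deg: "Polynomial.degree ?P = k"
    using assms by (subst degree_add_eq_left) (simp_all add: degree_monom_eq)
  then have "?P \<noteq> 0"
    using assms by (metis degree_0 less_irrefl)
  then have "card {x. poly ?P x = 0} \<le> k"
    using card_poly_roots_bound deg by metis
  then show ?thesis
    by (simp add: poly_monom)
qed

text \<open>
  There are at most \<open>Q\<close> fixed points of \<open>x \<mapsto> x ^ Q\<close>, being roots of a polynomial of degree \<open>Q\<close>.
  On the other hand all \<open>d\<close>-th powers are fixed since \<open>d (Q - 1) = q - 1\<close>, and the \<open>q - 1\<close> units have
  at least \<open>(q - 1) / d = Q - 1\<close> different \<open>d\<close>-th powers because the fibers have at most \<open>d\<close> elements.
\<close>

lemma card_frobenius_fixed_points:
  assumes "card (UNIV :: 'k::finite_field set) = q" and "d * (Q - 1) = q - 1" and "Q > 1" and "d > 0"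
  shows "card {x::'k. x ^ Q = x} = Q"
proof (rule antisym)
  let ?K = "{x::'k. x ^ Q = x}"
  let ?P = "monom (1::'k) Q + monom (- 1) 1"
  have deg: "Polynomial.degree ?P = Q"
    using \<open>Q > 1\<close> by (subst degree_add_eq_left) (simp_all add: degree_monom_eq)
  then have "?P \<noteq> 0"
    using \<open>Q > 1\<close> by (metis degree_0 not_less0)
  then have "card {x. poly ?P x = 0} \<le> Q"
    using card_poly_roots_bound deg by metis
  then show "card ?K \<le> Q"
    by (simp add: poly_monom)
  have pow: "(x ^ d) ^ Q = x ^ d" for x :: 'k
  proof (cases "x = 0")
    case False
    have "x * x ^ (q - 1) = x * 1"
      using finite_field_power_card_eq_same[of x] assms(1)
      by (metis finite_UNIV_card_ge_0 finite mult.right_neutral power_minus_mult mult.commute)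
    then have "(x ^ d) ^ (Q - 1) = 1"
      using False unfolding power_mult[symmetric] assms(2) by simp
    then show ?thesis
      using \<open>Q > 1\<close> power_minus_mult[of Q "x ^ d"] by simp
  qed (use \<open>d > 0\<close> \<open>Q > 1\<close> in \<open>simp add: power_0_left\<close>)
  \<comment> \<open>the units are covered by the fibers of the power map over the nonzero fixed points\<close>
  have "UNIV - {0} \<subseteq> (\<Union>y\<in>?K - {0}. {x::'k. x ^ d = y})"
    using pow by auto
  then have "card (UNIV - {0::'k}) \<le> card (\<Union>y\<in>?K - {0}. {x::'k. x ^ d = y})"
    by (intro card_mono) auto
  also have "\<dots> \<le> (\<Sum>y\<in>?K - {0}. card {x::'k. x ^ d = y})"
    by (intro card_UN_le) simp
  also have "\<dots> \<le> (\<Sum>y\<in>?K - {0}. d)"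
    using \<open>d > 0\<close> by (intro sum_mono card_power_fiber_le)
  also have "\<dots> = d * (card ?K - 1)"
    using \<open>Q > 1\<close> by (subst sum_constant, subst card_Diff_singleton) (auto simp: power_0_left)
  finally have "d * (Q - 1) \<le> d * (card ?K - 1)"
    using assms(1,2) by (simp add: card_Diff_singleton)
  then have "Q - 1 \<le> card ?K - 1"
    using \<open>d > 0\<close> by simp
  then show "Q \<le> card ?K"
    using \<open>Q > 1\<close> by linarith
qed

text \<open>
  Multiplication by a nonzero \<open>x \<in> K\<close> permutes the nonzero elements of \<open>K\<close>; comparing their product
  before and after gives \<open>x ^ (Q - 1) = 1\<close>.
\<close>

lemma in_GF_imp_power_eq:
  fixes x :: "'k::finite_field"
  assumes "in_GF Q x"
  shows "x ^ Q = x"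
proof (cases "x = 0")
  case True
  obtain K where "card K = Q" "x \<in> K"
    using assms by (auto simp: in_GF_def)
  then have "Q > 0"
    using card_gt_0_iff by fastforce
  with True show ?thesis
    by (simp add: power_0_left)
next
  case False
  obtain K where K: "subfield K (ring_of_type_algebra :: 'k ring)" "card K = Q" "x \<in> K"
    using assms by (auto simp: in_GF_def)
  interpret R: field "ring_of_type_algebra :: 'k ring"
    by (rule field_from_type_algebra)
  have mult: "y * z \<in> K" if "y \<in> K" "z \<in> K" for y z
    using subringE(6)[OF subfieldE(1)[OF K(1)]] that by (simp add: ring_of_type_algebra_def)
  have "0 \<in> K"
    using subringE(2)[OF subfieldE(1)[OF K(1)]] by (simp add: ring_of_type_algebra_def)
  have inj: "inj_on ((*) x) (K - {0})"
    using False by (auto intro: inj_onI)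
  have "(*) x ` (K - {0}) = K - {0}"
    using inj mult K(3) False by (intro endo_inj_surj) auto
  then have "\<Prod>(K - {0}) = prod ((*) x) (K - {0})"
    using inj by (metis (no_types, lifting) prod.reindex_cong)
  also have "\<dots> = x ^ (Q - 1) * \<Prod>(K - {0})"
    using \<open>0 \<in> K\<close> K(2) by (simp add: prod.distrib card_Diff_singleton)
  finally have "x ^ (Q - 1) = 1"
    by simp
  moreover have "Q > 0"
    using K by (metis card_gt_0_iff empty_iff finite)
  ultimately show ?thesis
    using power_minus_mult[of Q x] by simp
qed

text \<open>
  The fixed points of a power of the Frobenius endomorphism form a subfield.
\<close>

lemma in_GF_if_power_eq:
  fixes x :: "'k::finite_field"
  assumes p: "prime p" "CHAR('k) = p" and card: "card {x::'k. x ^ (p ^ r) = x} = p ^ r"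
    and x: "x ^ (p ^ r) = x"
  shows "in_GF (p ^ r) x"
proof -
  let ?R = "ring_of_type_algebra :: 'k ring" and ?K = "{x::'k. x ^ (p ^ r) = x}"
  interpret R: field ?R
    by (rule field_from_type_algebra)
  have add: "(y + z) ^ (p ^ r) = y ^ (p ^ r) + z ^ (p ^ r)" for y z :: 'k
    using p by (intro freshmans_dream') auto
  have zero: "(0::'k) ^ (p ^ r) = 0"
    using p by (simp add: power_0_left prime_gt_0_nat)
  have uminus: "(- y) ^ (p ^ r) = - (y ^ (p ^ r))" for y :: 'k
    using add[of y "- y"] zero by (simp add: eq_neg_iff_add_eq_0 add.commute)
  have R_simps: "carrier ?R = UNIV" "\<zero>\<^bsub>?R\<^esub> = 0" "\<one>\<^bsub>?R\<^esub> = 1"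
      "x \<otimes>\<^bsub>?R\<^esub> y = x * y" "x \<oplus>\<^bsub>?R\<^esub> y = x + y" for x y
    by (simp_all add: ring_of_type_algebra_def)
  have inv: "inv\<^bsub>?R\<^esub> y = inverse y" if "y \<noteq> 0" for y
    using that by (intro R.comm_inv_char) (auto simp: R_simps)
  have uminus': "\<ominus>\<^bsub>?R\<^esub> y = - y" for y
    by (intro R.minus_equality) (auto simp: R_simps)
  have "subfield ?K ?R"
  proof (rule R.subfieldI')
    show "subring ?K ?R"
      by (rule R.subringI) (auto simp: R_simps uminus' uminus add power_mult_distrib)
    show "inv\<^bsub>?R\<^esub> k \<in> ?K" if "k \<in> ?K - {\<zero>\<^bsub>?R\<^esub>}" for k
    proof -
      have "k \<noteq> 0" using that by (auto simp: R_simps)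
      with that inv show ?thesis by (simp add: power_inverse)
    qed
  qed
  then show ?thesis
    unfolding in_GF_def using card x by blast
qed


section \<open>Homogeneous polynomials\<close>

definition monom_degree :: "(nat \<Rightarrow>\<^sub>0 nat) \<Rightarrow> nat" where
  "monom_degree m = (\<Sum>i\<in>Poly_Mapping.keys m. Poly_Mapping.lookup m i)"

lemma homogeneous_alt: "homogeneous d F \<longleftrightarrow> (\<forall>m\<in>Poly_Mapping.keys F. monom_degree m = d)"
  by (simp add: homogeneous_def monom_degree_def)

lemma monom_degree_superset:
  assumes "finite S" "Poly_Mapping.keys m \<subseteq> S"
  shows "monom_degree m = (\<Sum>i\<in>S. Poly_Mapping.lookup m i)"
  unfolding monom_degree_def
  by (intro sum.mono_neutral_left) (use assms in \<open>auto simp: in_keys_iff\<close>)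

lemma monom_degree_add: "monom_degree (m + l) = monom_degree m + monom_degree l"
proof -
  let ?S = "Poly_Mapping.keys m \<union> Poly_Mapping.keys l"
  have "Poly_Mapping.keys (m + l) \<subseteq> ?S" by (rule keys_add)
  then show ?thesis
    by (simp add: monom_degree_superset[of ?S] lookup_add sum.distrib)
qed

lemma lookup_le_monom_degree: "Poly_Mapping.lookup m i \<le> monom_degree m"
  by (cases "i \<in> Poly_Mapping.keys m")
     (auto simp: monom_degree_def not_in_keys_iff_lookup_eq_zero intro: member_le_sum)

lemma keys_partial_deriv:
  assumes "m \<in> Poly_Mapping.keys (partial_deriv i F)"
  shows "m + Poly_Mapping.single i 1 \<in> Poly_Mapping.keys F"
proof -
  have "(\<Sum>l\<in>Poly_Mapping.keys F. Poly_Mapping.lookup (Poly_Mapping.single (l - Poly_Mapping.single i 1)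
      (of_nat (Poly_Mapping.lookup l i) * Poly_Mapping.lookup F l)) m) \<noteq> 0"
    using assms by (simp add: partial_deriv_def in_keys_iff lookup_sum)
  then obtain l where l: "l \<in> Poly_Mapping.keys F"
      "Poly_Mapping.lookup (Poly_Mapping.single (l - Poly_Mapping.single i 1)
        (of_nat (Poly_Mapping.lookup l i) * Poly_Mapping.lookup F l)) m \<noteq> 0"
    by (meson sum.neutral)
  then have "m = l - Poly_Mapping.single i 1"
    by (auto simp: lookup_single when_def split: if_splits)
  moreover have "Poly_Mapping.lookup l i \<noteq> 0"
    using l(2) by (intro notI) simp
  ultimately have "m + Poly_Mapping.single i 1 = l"
    by (intro poly_mapping_eqI) (auto simp: lookup_add lookup_minus lookup_single when_def)
  with l show ?thesis by simp
qed

lemma homogeneous_partial_deriv: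
  assumes "homogeneous d F"
  shows "homogeneous (d - 1) (partial_deriv i F)"
  unfolding homogeneous_alt
proof
  fix m assume "m \<in> Poly_Mapping.keys (partial_deriv i F)"
  then have "monom_degree (m + Poly_Mapping.single i 1) = d"
    using assms keys_partial_deriv by (auto simp: homogeneous_alt)
  then show "monom_degree m = d - 1"
    by (simp add: monom_degree_add) (simp add: monom_degree_def)
qed

lemma vars_partial_deriv: "vars (partial_deriv i F) \<subseteq> vars F"
proof
  fix j assume "j \<in> vars (partial_deriv i F)"
  then obtain m where m: "m \<in> Poly_Mapping.keys (partial_deriv i F)" "j \<in> Poly_Mapping.keys m"
    by (auto simp: vars_def)
  then have "j \<in> Poly_Mapping.keys (m + Poly_Mapping.single i 1)"
    by (simp add: in_keys_iff lookup_add)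
  with keys_partial_deriv[OF m(1)] show "j \<in> vars F"
    by (auto simp: vars_def)
qed

text \<open>
  Multiplying by \<open>X\<^sub>i\<close> undoes the shift of exponents, so that the derivation \<open>X\<^sub>i \<partial>/\<partial>X\<^sub>i\<close> is diagonal on
  monomials.
\<close>

lemma partial_deriv_mult_Var:
  "partial_deriv i F * Var i = (\<Sum>m\<in>Poly_Mapping.keys F.
     Poly_Mapping.single m (of_nat (Poly_Mapping.lookup m i) * Poly_Mapping.lookup F m))"
  unfolding partial_deriv_def sum_distrib_right Var_def
proof (intro sum.cong refl)
  fix m
  show "Poly_Mapping.single (m - Poly_Mapping.single i 1)
      (of_nat (Poly_Mapping.lookup m i) * Poly_Mapping.lookup F m) *
      Poly_Mapping.single (Poly_Mapping.single i 1) 1 =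
    Poly_Mapping.single m (of_nat (Poly_Mapping.lookup m i) * Poly_Mapping.lookup F m)"
  proof (cases "Poly_Mapping.lookup m i = 0")
    case False
    then have "m - Poly_Mapping.single i 1 + Poly_Mapping.single i 1 = m"
      by (intro poly_mapping_eqI) (auto simp: lookup_add lookup_minus lookup_single when_def)
    then show ?thesis
      by (simp add: mult_single)
  qed simp
qed

lemma euler_homogeneous:
  assumes "homogeneous d F" "vars F \<subseteq> S" "finite S"
  shows "(\<Sum>i\<in>S. partial_deriv i F * Var i) = of_nat d * F"
proof -
  have deg: "(\<Sum>i\<in>S. Poly_Mapping.lookup m i) = d" if "m \<in> Poly_Mapping.keys F" for m
  proof -
    have "Poly_Mapping.keys m \<subseteq> S"
      using assms(2) that by (auto simp: vars_def)
    then show ?thesis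
      using assms(1) that monom_degree_superset[OF assms(3)] by (metis homogeneous_alt)
  qed
  have "(\<Sum>i\<in>S. partial_deriv i F * Var i) = (\<Sum>m\<in>Poly_Mapping.keys F. \<Sum>i\<in>S.
      Poly_Mapping.single m (of_nat (Poly_Mapping.lookup m i) * Poly_Mapping.lookup F m))"
    unfolding partial_deriv_mult_Var by (rule sum.swap)
  also have "\<dots> = (\<Sum>m\<in>Poly_Mapping.keys F. Poly_Mapping.single m (of_nat d * Poly_Mapping.lookup F m))"
  proof (intro sum.cong refl)
    fix m assume "m \<in> Poly_Mapping.keys F"
    have "(\<Sum>i\<in>S. Poly_Mapping.single m (of_nat (Poly_Mapping.lookup m i) * Poly_Mapping.lookup F m)) =
        Poly_Mapping.single m (\<Sum>i\<in>S. of_nat (Poly_Mapping.lookup m i) * Poly_Mapping.lookup F m)"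
      using assms(3) by (induction S rule: finite_induct) (simp_all add: single_add)
    also have "(\<Sum>i\<in>S. of_nat (Poly_Mapping.lookup m i) * Poly_Mapping.lookup F m) =
        of_nat d * Poly_Mapping.lookup F m"
      using deg[OF \<open>m \<in> _\<close>] by (simp flip: sum_distrib_right of_nat_sum)
    finally show "(\<Sum>i\<in>S. Poly_Mapping.single m (of_nat (Poly_Mapping.lookup m i) * Poly_Mapping.lookup F m)) =
        Poly_Mapping.single m (of_nat d * Poly_Mapping.lookup F m)" .
  qed
  also have "\<dots> = of_nat d * (\<Sum>m\<in>Poly_Mapping.keys F. Poly_Mapping.single m (Poly_Mapping.lookup F m))"
    unfolding of_nat_mpoly Const_def by (simp only: sum_distrib_left mult_single add_0)
  also have "\<dots> = of_nat d * F"
    unfolding poly_mapping_sum_terms ..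
  finally show ?thesis .
qed


section \<open>Frobenius powers of polynomials\<close>

lemma mpoly_freshmans_dream_sum:
  fixes f :: "'i \<Rightarrow> 'a::comm_ring_1 mpoly"
  assumes "prime p" "CHAR('a) = p"
  shows "(\<Sum>i\<in>I. f i) ^ (p ^ r) = (\<Sum>i\<in>I. f i ^ (p ^ r))"
  by (rule freshmans_dream_sum') (use assms in \<open>simp_all add: CHAR_mpoly\<close>)

lemma frobenius_power_terms:
  fixes F :: "'a::comm_ring_1 mpoly"
  assumes "prime p" "CHAR('a) = p"
  shows "F ^ (p ^ r) = (\<Sum>m\<in>Poly_Mapping.keys F.
    Poly_Mapping.single (of_nat (p ^ r) * m) (Poly_Mapping.lookup F m ^ (p ^ r)))"
proof -
  have "F ^ (p ^ r) = (\<Sum>m\<in>Poly_Mapping.keys F. Poly_Mapping.single m (Poly_Mapping.lookup F m)) ^ (p ^ r)"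
    by (simp only: poly_mapping_sum_terms)
  also have "\<dots> = (\<Sum>m\<in>Poly_Mapping.keys F. Poly_Mapping.single m (Poly_Mapping.lookup F m) ^ (p ^ r))"
    by (rule mpoly_freshmans_dream_sum) fact+
  finally show ?thesis
    unfolding single_power .
qed

lemma dvd_exponents_frobenius_power:
  fixes F :: "'a::comm_ring_1 mpoly"
  assumes "prime p" "CHAR('a) = p" and "m \<in> Poly_Mapping.keys (F ^ (p ^ r))"
  shows "p ^ r dvd Poly_Mapping.lookup m i"
proof -
  obtain l where "l \<in> Poly_Mapping.keys F"
      "m \<in> Poly_Mapping.keys (Poly_Mapping.single (of_nat (p ^ r) * l) (Poly_Mapping.lookup F l ^ (p ^ r)))"
    using assms(3) keys_sum unfolding frobenius_power_terms[OF assms(1,2)] by fast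
  then have "m = of_nat (p ^ r) * l"
    by (simp split: if_splits)
  then show ?thesis
    by (simp only: lookup_of_nat_mult dvd_triv_left)
qed

text \<open>
  By additivity the difference has vanishing \<open>p ^ r\<close>-th power, and the polynomial ring is a domain.
\<close>

lemma frobenius_power_inject:
  fixes F G :: "'a::field mpoly"
  assumes "prime p" "CHAR('a) = p" and "F ^ (p ^ r) = G ^ (p ^ r)"
  shows "F = G"
proof -
  have "(G + (F - G)) ^ (p ^ r) = G ^ (p ^ r) + (F - G) ^ (p ^ r)"
    by (rule freshmans_dream') (use assms in \<open>simp_all add: CHAR_mpoly\<close>)
  then have "(F - G) ^ (p ^ r) = 0"
    using assms(3) by simp
  then show ?thesis
    by simp
qed

text \<open>
  Powers \<open>F ^ (p ^ r)\<close> with \<open>r > 0\<close> behave like constants under differentiation.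
\<close>

lemma partial_deriv_frobenius_power_mult_Var:
  fixes F :: "'a::comm_ring_1 mpoly"
  assumes p: "prime p" "CHAR('a) = p" and "r > 0"
  shows "partial_deriv j (F ^ (p ^ r) * Var i) = (if i = j then F ^ (p ^ r) else 0)"
proof -
  have 0: "of_nat (p ^ r) = (0::'a)"
    unfolding of_nat_eq_0_iff_char_dvd using assms by simp
  have "F ^ (p ^ r) * Var i = (\<Sum>m\<in>Poly_Mapping.keys F.
      Poly_Mapping.single (of_nat (p ^ r) * m + Poly_Mapping.single i 1) (Poly_Mapping.lookup F m ^ (p ^ r)))"
    unfolding frobenius_power_terms[OF p] Var_def sum_distrib_right mult_single by simp
  also have "partial_deriv j \<dots> = (\<Sum>m\<in>Poly_Mapping.keys F. if i = j then
      Poly_Mapping.single (of_nat (p ^ r) * m) (Poly_Mapping.lookup F m ^ (p ^ r)) else 0)"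
    unfolding partial_deriv_sum partial_deriv_single lookup_add lookup_of_nat_mult of_nat_add of_nat_mult 0
    by (intro sum.cong refl) (simp add: lookup_single when_def)
  finally show ?thesis
    by (simp add: frobenius_power_terms[OF p])
qed

text \<open>
  In a field with \<open>p ^ s\<close> elements the \<open>p ^ r\<close>-th root of \<open>c\<close> is \<open>c ^ (p ^ (s - r))\<close>. The root of the
  polynomial is obtained by taking roots of the coefficients and dividing the exponents by \<open>p ^ r\<close>.
\<close>

lemma exists_frobenius_root:
  fixes F :: "'k::finite_field mpoly"
  assumes p: "prime p" "CHAR('k) = p" and card: "card (UNIV :: 'k set) = p ^ s" and "r \<le> s"
    and dvd: "\<And>m i. m \<in> Poly_Mapping.keys F \<Longrightarrow> p ^ r dvd Poly_Mapping.lookup m i"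
    and hom: "homogeneous e F"
  shows "\<exists>A. A ^ (p ^ r) = F \<and> vars A \<subseteq> vars F \<and> homogeneous (e div p ^ r) A"
proof -
  define Q where "Q = p ^ r"
  have "Q > 0" using p by (simp add: Q_def prime_gt_0_nat)
  define h :: "(nat \<Rightarrow>\<^sub>0 nat) \<Rightarrow> nat \<Rightarrow>\<^sub>0 nat" where "h = Poly_Mapping.map (\<lambda>k. k div Q)"
  have lookup_h: "Poly_Mapping.lookup (h m) i = Poly_Mapping.lookup m i div Q" for m i
    by (simp add: h_def map.rep_eq when_def)
  have scale_h: "of_nat Q * h m = m" if "m \<in> Poly_Mapping.keys F" for m
    using dvd[OF that, folded Q_def] by (intro poly_mapping_eqI) (simp add: lookup_of_nat_mult lookup_h)
  define A where "A = (\<Sum>m\<in>Poly_Mapping.keys F.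
    Poly_Mapping.single (h m) (Poly_Mapping.lookup F m ^ (p ^ (s - r))))"
  have "c ^ (p ^ (s - r) * Q) = c" for c :: 'k
    using finite_field_power_card_eq_same[of c] \<open>r \<le> s\<close> card
    by (simp add: Q_def flip: power_add)
  then have root: "(c ^ (p ^ (s - r))) ^ Q = c" for c :: 'k
    by (simp add: power_mult)
  have "A ^ Q = (\<Sum>m\<in>Poly_Mapping.keys F.
      Poly_Mapping.single (of_nat Q * h m) ((Poly_Mapping.lookup F m ^ (p ^ (s - r))) ^ Q))"
    unfolding A_def Q_def mpoly_freshmans_dream_sum[OF p] single_power ..
  also have "\<dots> = (\<Sum>m\<in>Poly_Mapping.keys F. Poly_Mapping.single m (Poly_Mapping.lookup F m))"
    by (intro sum.cong refl) (simp only: scale_h root)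
  also have "\<dots> = F"
    by (rule poly_mapping_sum_terms)
  finally have "A ^ (p ^ r) = F"
    unfolding Q_def .
  moreover have keys_A: "\<exists>m\<in>Poly_Mapping.keys F. l = h m" if l: "l \<in> Poly_Mapping.keys A" for l
  proof -
    obtain m where "m \<in> Poly_Mapping.keys F"
        "l \<in> Poly_Mapping.keys (Poly_Mapping.single (h m) (Poly_Mapping.lookup F m ^ (p ^ (s - r))))"
      using subsetD[OF keys_sum l[unfolded A_def]] by blast
    then show ?thesis
      by (auto split: if_splits)
  qed
  moreover have keys_h: "Poly_Mapping.keys (h m) \<subseteq> Poly_Mapping.keys m" for m
    by (metis lookup_h div_0 in_keys_iff subsetI)
  then have "vars A \<subseteq> vars F"
    unfolding vars_def using keys_A by blast
  moreover have "homogeneous (e div Q) A"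
    unfolding homogeneous_alt
  proof
    fix l assume "l \<in> Poly_Mapping.keys A"
    then obtain m where m: "m \<in> Poly_Mapping.keys F" "l = h m"
      using keys_A by blast
    have "monom_degree l = (\<Sum>i\<in>Poly_Mapping.keys m. Poly_Mapping.lookup (h m) i)"
      using m keys_h by (simp add: monom_degree_superset)
    then have "Q * monom_degree l = (\<Sum>i\<in>Poly_Mapping.keys m. Poly_Mapping.lookup (of_nat Q * h m) i)"
      by (simp only: sum_distrib_left lookup_of_nat_mult)
    also have "\<dots> = monom_degree m"
      using scale_h[OF m(1)] by (simp add: monom_degree_def)
    also have "\<dots> = e"
      using hom m by (simp add: homogeneous_alt)
    finally show "monom_degree l = e div Q"
      using \<open>Q > 0\<close> by auto
  qed
  ultimately show ?thesis
    unfolding Q_def by blast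
qed

text \<open>
  As the degree \<open>e\<close> of the forms \<open>g j\<close> is less than \<open>q\<close>, a monomial of \<open>g j * X\<^sub>j ^ q\<close> has exponent at
  least \<open>q\<close> in \<open>X\<^sub>j\<close> and less than \<open>q\<close> in the other variables. Hence nothing cancels in the sum, and
  divisibility properties of the exponents pass from the sum to each summand.
\<close>

lemma dvd_exponents_if_combination_of_powers:
  assumes hom: "\<And>j. j \<in> S \<Longrightarrow> homogeneous e (g j)" and "e < q" and "finite S" and "Q dvd q"
    and dvd: "\<And>m i. m \<in> Poly_Mapping.keys (\<Sum>j\<in>S. g j * Var j ^ q) \<Longrightarrow> Q dvd Poly_Mapping.lookup m i"
    and j: "j \<in> S" and m: "m \<in> Poly_Mapping.keys (g j)"
  shows "Q dvd Poly_Mapping.lookup m i"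
proof -
  let ?l = "m + Poly_Mapping.single j q"
  have "Poly_Mapping.lookup (g k * Var k ^ q) ?l = (if k = j then Poly_Mapping.lookup (g j) m else 0)"
    if "k \<in> S" for k
  proof (cases "k = j")
    case True
    then show ?thesis
      by (simp add: Var_power lookup_mult_single)
  next
    case False
    have "?l \<noteq> k' + Poly_Mapping.single k q" for k'
    proof
      assume "?l = k' + Poly_Mapping.single k q"
      then have "Poly_Mapping.lookup ?l k = Poly_Mapping.lookup (k' + Poly_Mapping.single k q) k"
        by simp
      then have "Poly_Mapping.lookup m k \<ge> q"
        using False by (simp add: lookup_add lookup_single when_def)
      moreover have "Poly_Mapping.lookup m k \<le> e"
        using lookup_le_monom_degree[of m k] hom[OF j] m by (simp add: homogeneous_alt)
      ultimately show False
        using \<open>e < q\<close> by simp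
    qed
    then show ?thesis
      using False by (simp add: Var_power lookup_mult_single_not_multiple)
  qed
  then have "Poly_Mapping.lookup (\<Sum>k\<in>S. g k * Var k ^ q) ?l = Poly_Mapping.lookup (g j) m"
    using \<open>finite S\<close> j by (simp add: lookup_sum)
  then have "?l \<in> Poly_Mapping.keys (\<Sum>k\<in>S. g k * Var k ^ q)"
    using m by (simp add: in_keys_iff)
  then have "Q dvd Poly_Mapping.lookup ?l i"
    by (rule dvd)
  then show ?thesis
    using \<open>Q dvd q\<close> by (auto simp: lookup_add lookup_single when_def dvd_add_left_iff split: if_splits)
qed

section \<open>Forms whose Frobenius form is a Frobenius power\<close>

text \<open>
  The right hand side of the hypothesis \<open>eq\<close> only involves \<open>p ^ r\<close>-th powers of monomials. Since the
  partial derivatives have degree \<open>d - 1 < q\<close>, no cancellation occurs on the left, so each partial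
  derivative is itself a \<open>p ^ r\<close>-th power \<open>A i ^ (p ^ r)\<close>. The first formula for \<open>g\<close> is then Euler's
  identity, and the second is the hypothesis with \<open>p ^ r\<close>-th roots taken on both sides.
\<close>

lemma frobenius_decomposition:
  fixes g :: "'k::finite_field mpoly"
  assumes p: "prime p" "CHAR('k) = p" and q: "card (UNIV :: 'k set) = q" "q = p ^ s" and "r \<le> s"
    and hom: "homogeneous d g" and "vars g \<subseteq> S" "finite S"
    and d: "of_nat d = (1::'k)" "d - 1 < q"
    and eq: "(\<Sum>i\<in>S. partial_deriv i g * Var i ^ q) = g ^ (p ^ r)"
  shows "\<exists>A. (\<forall>i\<in>S. vars (A i) \<subseteq> S \<and> homogeneous ((d - 1) div p ^ r) (A i)) \<and>
    g = (\<Sum>i\<in>S. A i ^ (p ^ r) * Var i) \<and> g = (\<Sum>i\<in>S. A i * Var i ^ (q div p ^ r))"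
proof -
  have "p ^ r dvd q"
    using \<open>r \<le> s\<close> q by (simp add: le_imp_power_dvd)
  have dvd: "p ^ r dvd Poly_Mapping.lookup m j"
    if "i \<in> S" "m \<in> Poly_Mapping.keys (partial_deriv i g)" for i m j
  proof (rule dvd_exponents_if_combination_of_powers[where g = "\<lambda>i. partial_deriv i g" and S = S and q = q])
    show "homogeneous (d - 1) (partial_deriv k g)" for k
      by (rule homogeneous_partial_deriv[OF hom])
    show "p ^ r dvd Poly_Mapping.lookup l k"
      if "l \<in> Poly_Mapping.keys (\<Sum>k\<in>S. partial_deriv k g * Var k ^ q)" for l k
      using that unfolding eq by (rule dvd_exponents_frobenius_power[OF p])
  qed fact+
  have "\<exists>A. A ^ (p ^ r) = partial_deriv i g \<and> vars A \<subseteq> vars (partial_deriv i g) \<and>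
      homogeneous ((d - 1) div p ^ r) A" if "i \<in> S" for i
    using exists_frobenius_root[OF p q(1)[unfolded q(2)] \<open>r \<le> s\<close>] dvd[OF that] homogeneous_partial_deriv[OF hom]
    by blast
  then obtain A where A: "\<And>i. i \<in> S \<Longrightarrow> A i ^ (p ^ r) = partial_deriv i g"
      "\<And>i. i \<in> S \<Longrightarrow> vars (A i) \<subseteq> vars (partial_deriv i g)"
      "\<And>i. i \<in> S \<Longrightarrow> homogeneous ((d - 1) div p ^ r) (A i)"
    by metis
  have "of_nat d = (1 :: 'k mpoly)"
    unfolding of_nat_mpoly d(1) Const_1 ..
  then have "(\<Sum>i\<in>S. partial_deriv i g * Var i) = g"
    using euler_homogeneous[OF hom \<open>vars g \<subseteq> S\<close> \<open>finite S\<close>] by simp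
  then have "g = (\<Sum>i\<in>S. A i ^ (p ^ r) * Var i)"
    using A(1) by simp
  moreover have "g = (\<Sum>i\<in>S. A i * Var i ^ (q div p ^ r))"
  proof (rule frobenius_power_inject[OF p])
    have "(\<Sum>i\<in>S. A i * Var i ^ (q div p ^ r)) ^ (p ^ r) = (\<Sum>i\<in>S. A i ^ (p ^ r) * Var i ^ q)"
      using \<open>p ^ r dvd q\<close>
      by (simp add: mpoly_freshmans_dream_sum[OF p] power_mult_distrib flip: power_mult)
    also have "\<dots> = g ^ (p ^ r)"
      unfolding eq[symmetric] using A(1) by simp
    finally show "g ^ (p ^ r) = (\<Sum>i\<in>S. A i * Var i ^ (q div p ^ r)) ^ (p ^ r)" ..
  qed
  ultimately show ?thesis
    using A(2,3) vars_partial_deriv \<open>vars g \<subseteq> S\<close> by (intro exI[of _ A]) blast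
qed

text \<open>
  By the first expression for \<open>g\<close> its partial derivatives are the \<open>A i ^ (p ^ r)\<close>; the second one says
  that the resulting sum is a \<open>p ^ r\<close>-th power.
\<close>

lemma frobenius_form_if_decomposition:
  fixes g :: "'a::comm_ring_1 mpoly"
  assumes p: "prime p" "CHAR('a) = p" and "r > 0" and "p ^ r dvd q" and "finite S"
    and g: "g = (\<Sum>i\<in>S. A i ^ (p ^ r) * Var i)" "g = (\<Sum>i\<in>S. A i * Var i ^ (q div p ^ r))"
  shows "(\<Sum>i\<in>S. partial_deriv i g * Var i ^ q) = g ^ (p ^ r)"
proof -
  have "partial_deriv j g = A j ^ (p ^ r)" if "j \<in> S" for j
    using \<open>finite S\<close> that
    by (subst g(1)) (simp add: partial_deriv_sum partial_deriv_frobenius_power_mult_Var[OF p \<open>r > 0\<close>])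
  then have "(\<Sum>i\<in>S. partial_deriv i g * Var i ^ q) = (\<Sum>i\<in>S. (A i * Var i ^ (q div p ^ r)) ^ (p ^ r))"
    using \<open>p ^ r dvd q\<close> by (simp add: power_mult_distrib flip: power_mult)
  also have "\<dots> = g ^ (p ^ r)"
    by (subst g(2)) (simp only: mpoly_freshmans_dream_sum[OF p])
  finally show ?thesis .
qed


section \<open>Sums of a ternary form and a diagonal form\<close>

text \<open>
  The condition that the Frobenius image of \<open>x\<close> is a point of projective space holds automatically.
\<close>

lemma frobenius_nonclassical_iff:
  assumes "q > 0"
  shows "frobenius_nonclassical q n F \<longleftrightarrow>
    (\<forall>x\<in>proj_space n. eval_ac x F = 0 \<longrightarrow> (\<exists>i\<le>n. eval_ac x (partial_deriv i F) \<noteq> 0) \<longrightarrow>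
      (\<Sum>i\<le>n. eval_ac x (partial_deriv i F) * x i ^ q) = 0)"
proof -
  have "frob q x \<in> proj_space n" if "x \<in> proj_space n" for x :: "nat \<Rightarrow> 'a alg_closure"
    using that assms by (auto simp: proj_space_def frob_def)
  then show ?thesis
    by (auto simp: frobenius_nonclassical_def regular_locus_def tangent_hyperplane_def
        hypersurface_def eval_ac_def partial_deriv_base_change frob_def)
qed

text \<open>
  Regularity along the plane section \<open>X\<^sub>3 = \<dots> = X\<^sub>n = 0\<close> is kept out of this setting; it enters
  through its consequence \<open>G \<noteq> 0\<close>, which is an explicit premise of the lemmas that rely on it.
\<close>

locale ternary_plus_diagonal =
  fixes p s q n d :: nat
    and a :: "nat \<Rightarrow> 'k::finite_field"
    and F G :: "'k mpoly"
  assumes p: "prime p" "p \<noteq> 2" and q: "q = p ^ s" "card (UNIV :: 'k set) = q"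
    and n: "n > 3" and d: "d > 2"
    and F: "F = G + (\<Sum>i=3..n. Const (a i) * Var i ^ d)"
    and vars_G: "vars G \<subseteq> {..2}"
    and hom_F: "homogeneous d F"
    and a: "\<And>i. i \<in> {3..n} \<Longrightarrow> a i \<noteq> 0"
    and not_dvd: "\<not> p dvd d"
begin

lemma char: "CHAR('k) = p"
  using CHAR_eq_if_card_prime_power p q by blast

lemma q_gt_1: "q > 1"
proof -
  have "{0, 1} \<subseteq> (UNIV :: 'k set)" by simp
  then have "card {0, 1 :: 'k} \<le> q"
    unfolding q(2)[symmetric] by (intro card_mono) auto
  then show ?thesis by simp
qed

lemma prime_power_gt_1: "r > 0 \<Longrightarrow> p ^ r > 1"
  using p(1) by (meson one_less_power prime_gt_1_nat)

lemma of_nat_q: "of_nat q = (0::'k)"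
  using of_nat_card_UNIV[where ?'a = 'k] q(2) by simp

lemma of_nat_d: "of_nat d \<noteq> (0 :: 'k)"
  using not_dvd by (simp add: of_nat_eq_0_iff_char_dvd char)

text \<open>
  No cancellation is possible between \<open>G\<close> and the diagonal part, as they involve disjoint sets of
  variables.
\<close>

lemma hom_G: "homogeneous d G"
  unfolding homogeneous_alt
proof
  fix m assume m: "m \<in> Poly_Mapping.keys G"
  have "Poly_Mapping.lookup (Const (a i) * Var i ^ d) m = 0" if "i \<in> {3..n}" for i
  proof -
    have "i \<notin> Poly_Mapping.keys m"
      using m that vars_G by (fastforce simp: vars_def)
    then have "m \<noteq> Poly_Mapping.single i d"
      using d by auto
    then show ?thesis
      by (simp add: Const_mult_Var_power lookup_single_not_eq)
  qed
  then have "Poly_Mapping.lookup F m = Poly_Mapping.lookup G m"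
    by (simp add: F lookup_add lookup_sum)
  then have "m \<in> Poly_Mapping.keys F"
    using m by (simp add: in_keys_iff)
  then show "monom_degree m = d"
    using hom_F by (simp add: homogeneous_alt)
qed

lemma partial_deriv_F_ternary:
  assumes "i \<le> 2"
  shows "partial_deriv i F = partial_deriv i G"
  using assms
  by (auto simp: F partial_deriv_add partial_deriv_sum partial_deriv_Const_mult_Var_power
      intro!: sum.neutral)

lemma partial_deriv_F_diagonal:
  assumes "i \<in> {3..n}"
  shows "partial_deriv i F = Const (of_nat d * a i) * Var i ^ (d - 1)"
proof -
  have "i \<notin> vars G"
    using assms vars_G by auto
  then show ?thesis
    using assms
    by (simp add: F partial_deriv_add partial_deriv_sum partial_deriv_Const_mult_Var_power
        partial_deriv_not_in_vars)
qed

lemma eval_ac_F: "eval_ac x F = eval_ac x G + (\<Sum>i=3..n. to_ac (a i) * x i ^ d)"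
  by (simp add: F eval_ac_simps)

definition frobenius_form_G :: "'k mpoly" where
  "frobenius_form_G = (\<Sum>i\<le>2. partial_deriv i G * Var i ^ q)"

lemma frobenius_form_eq:
  "(\<Sum>i\<le>n. eval_ac x (partial_deriv i F) * x i ^ q) =
     eval_ac x frobenius_form_G + of_nat d * (\<Sum>i=3..n. to_ac (a i) * x i ^ (d - 1 + q))"
proof -
  have "{..n} = {..2} \<union> {3..n}" using n by auto
  then have "(\<Sum>i\<le>n. eval_ac x (partial_deriv i F) * x i ^ q) =
      (\<Sum>i\<le>2. eval_ac x (partial_deriv i F) * x i ^ q) +
      (\<Sum>i=3..n. eval_ac x (partial_deriv i F) * x i ^ q)"
    by (simp only:) (rule sum.union_disjoint, auto)
  also have "(\<Sum>i\<le>2. eval_ac x (partial_deriv i F) * x i ^ q) = eval_ac x frobenius_form_G"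
    by (simp add: frobenius_form_G_def eval_ac_simps partial_deriv_F_ternary)
  also have "(\<Sum>i=3..n. eval_ac x (partial_deriv i F) * x i ^ q) =
      of_nat d * (\<Sum>i=3..n. to_ac (a i) * x i ^ (d - 1 + q))"
    unfolding sum_distrib_left
    by (intro sum.cong refl)
       (simp add: partial_deriv_F_diagonal eval_ac_simps power_add mult.assoc)
  finally show ?thesis .
qed

lemma vars_frobenius_form_G: "vars frobenius_form_G \<subseteq> {..2}"
proof
  fix j assume "j \<in> vars frobenius_form_G"
  then obtain m where m: "m \<in> Poly_Mapping.keys frobenius_form_G" "j \<in> Poly_Mapping.keys m"
    by (auto simp: vars_def)
  then obtain i where i: "i \<le> 2" "m \<in> Poly_Mapping.keys (partial_deriv i G * Var i ^ q)"
    using keys_sum unfolding frobenius_form_G_def by fast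
  then obtain m' where "m' \<in> Poly_Mapping.keys (partial_deriv i G)" "m = m' + Poly_Mapping.single i q"
    using keys_mult[of "partial_deriv i G" "Var i ^ q"] by (auto simp: Var_power split: if_splits)
  then have "j \<in> vars (partial_deriv i G) \<or> j = i"
    using m(2) by (auto simp: vars_def in_keys_iff lookup_add lookup_single when_def split: if_splits)
  then show "j \<in> {..2}"
    using i(1) vars_partial_deriv vars_G by auto
qed

text \<open>
  The condition is tested on points whose coordinates vanish except for \<open>X\<^sub>0, X\<^sub>1, X\<^sub>2\<close>, which are
  taken from \<open>z\<close>, and for \<open>X\<^sub>i = t\<close> and \<open>X\<^sub>n = y\<close>. The hypothesis on \<open>y\<close> says that the point lies on the
  hypersurface. It is regular because the derivative with respect to \<open>X\<^sub>i\<close> is \<open>d a\<^sub>i t\<^bsup>d-1\<^esup> \<noteq> 0\<close>.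
\<close>

lemma nonclassical_slice:
  assumes FN: "frobenius_nonclassical q n F" and i: "i \<in> {3..n - 1}" and "t \<noteq> 0"
    and y: "to_ac (a n) * y ^ d = - (eval_ac z G + to_ac (a i) * t ^ d)"
  shows "eval_ac z frobenius_form_G +
    of_nat d * (to_ac (a i) * t ^ (d - 1 + q) + to_ac (a n) * y ^ (d - 1 + q)) = 0"
proof -
  define x where "x = (\<lambda>j. if j \<le> 2 then z j else if j = i then t else if j = n then y else 0)"
  have i': "i \<noteq> n" "i \<in> {3..n}" "i > 2" using i n by auto
  have x: "x i = t" "x n = y"
    using i' n by (auto simp: x_def)
  have sum: "(\<Sum>j=3..n. to_ac (a j) * x j ^ k) = to_ac (a i) * t ^ k + to_ac (a n) * y ^ k"
    if "k > 0" for k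
  proof -
    have "(\<Sum>j=3..n. to_ac (a j) * x j ^ k) = (\<Sum>j\<in>{i, n}. to_ac (a j) * x j ^ k)"
      using i' n that by (intro sum.mono_neutral_right) (auto simp: x_def)
    then show ?thesis
      using i' by (simp add: x)
  qed
  have eval: "eval_ac x H = eval_ac z H" if "vars H \<subseteq> {..2}" for H
    using that by (intro eval_ac_cong) (auto simp: x_def)
  have "x \<in> proj_space n"
    using \<open>t \<noteq> 0\<close> i' n x(1) by (auto simp: proj_space_def x_def intro!: exI[of _ i])
  moreover have "eval_ac x F = 0"
    using y d by (simp add: eval_ac_F sum eval vars_G)
  moreover have "eval_ac x (partial_deriv i F) \<noteq> 0"
    using i' a of_nat_d \<open>t \<noteq> 0\<close> x(1)
    by (simp add: partial_deriv_F_diagonal eval_ac_simps flip: to_ac_of_nat)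
  ultimately have "(\<Sum>i\<le>n. eval_ac x (partial_deriv i F) * x i ^ q) = 0"
    using FN frobenius_nonclassical_iff[of q n F] q_gt_1 i' by auto
  then show ?thesis
    using d by (simp add: frobenius_form_eq sum eval vars_frobenius_form_G)
qed

text \<open>
  If \<open>d - 1 + q\<close> is a multiple of \<open>d\<close>, the relation on the slice depends on \<open>t\<close> and \<open>y\<close> only through
  \<open>u = t ^ d\<close> and \<open>y ^ d\<close>. Over an algebraically closed field \<open>u\<close> is arbitrary.
\<close>

lemma nonclassical_line:
  assumes FN: "frobenius_nonclassical q n F" and i: "i \<in> {3..n - 1}" and N: "d - 1 + q = d * N"
    and "u \<noteq> 0"
  shows "eval_ac z frobenius_form_G + of_nat d * (to_ac (a i) * u ^ N +
    to_ac (a n) * (- (eval_ac z G + to_ac (a i) * u) / to_ac (a n)) ^ N) = 0"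
proof -
  let ?E = "- (eval_ac z G + to_ac (a i) * u) / to_ac (a n)"
  have "d > 0" using d by simp
  then obtain t where t: "t ^ d = u"
    using nth_root_exists by blast
  obtain y where y: "y ^ d = ?E"
    using nth_root_exists \<open>d > 0\<close> by blast
  have "to_ac (a n) \<noteq> 0"
    using a n by simp
  then have "to_ac (a n) * y ^ d = - (eval_ac z G + to_ac (a i) * t ^ d)"
    unfolding y t by simp
  moreover have "t \<noteq> 0"
    using t \<open>u \<noteq> 0\<close> \<open>d > 0\<close> by (auto simp: power_0_left)
  ultimately have "eval_ac z frobenius_form_G +
      of_nat d * (to_ac (a i) * t ^ (d - 1 + q) + to_ac (a n) * y ^ (d - 1 + q)) = 0"
    by (intro nonclassical_slice[OF FN i])
  then show ?thesis
    by (simp only: N power_mult y t)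
qed

lemma degree_relation_iff:
  assumes "r > 0"
  shows "d * (p ^ r - 1) = q - 1 \<longleftrightarrow> d - 1 + q = d * p ^ r"
proof -
  have "p ^ r \<ge> 1"
    using p(1) by (simp add: prime_gt_0_nat Suc_leI)
  then have "d \<le> d * p ^ r"
    by simp
  then show ?thesis
    using d q_gt_1 by (simp add: diff_mult_distrib2) linarith
qed

text \<open>
  Modulo \<open>p\<close>, the relation \<open>d p\<^sup>r + 1 = d + q\<close> reads \<open>1 = d\<close>.
\<close>

lemma of_nat_d_eq_1:
  assumes "d * (p ^ r - 1) = q - 1" "r > 0"
  shows "of_nat d = (1::'k)"
proof -
  have "d * p ^ r + 1 = d + q"
    using degree_relation_iff assms d by fastforce
  then have "of_nat (d * p ^ r + 1) = (of_nat (d + q) :: 'k)"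
    by simp
  moreover have "of_nat p = (0::'k)"
    using of_nat_CHAR[where ?'a = 'k] char by simp
  ultimately show ?thesis
    using assms(2) of_nat_q by (simp add: power_0_left)
qed

lemma exponent_le:
  assumes "d * (p ^ r - 1) = q - 1"
  shows "r \<le> s"
proof -
  have "p ^ r - 1 \<le> d * (p ^ r - 1)"
    using d by simp
  then have "p ^ r \<le> p ^ s"
    using assms q(1) q_gt_1 by linarith
  then show ?thesis
    using p(1) prime_gt_1_nat power_le_imp_le_exp by blast
qed

text \<open>
  Over a fixed point \<open>z\<close> with \<open>G(z) \<noteq> 0\<close> the relation on the slices is a polynomial identity in one
  variable, from which the shape of the exponent \<open>d - 1 + q\<close> can be read off.
\<close>

lemma nonclassical_degree:
  assumes FN: "frobenius_nonclassical q n F" and "G \<noteq> 0"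
  shows "\<exists>r>0. d * (p ^ r - 1) = q - 1 \<and> d - 1 + q = d * p ^ r"
proof -
  obtain z where z: "eval_ac z G \<noteq> 0"
    using eq_0_if_eval_ac_vanishing \<open>G \<noteq> 0\<close> by blast
  have 3: "3 \<in> {3..n - 1}" using n by simp
  have nz: "to_ac (a 3) \<noteq> 0" "to_ac (a n) \<noteq> 0" "of_nat d \<noteq> (0 :: 'k alg_closure)"
    using a n of_nat_d by (simp_all flip: to_ac_of_nat)
  have "d dvd d - 1 + q"
    using dvd_exponent_if_binomial_relation[OF z nz(1,2,3,3), of "d - 1 + q" "eval_ac z frobenius_form_G"]
      nonclassical_slice[OF FN 3] q_gt_1 by auto
  then obtain N where N: "d - 1 + q = d * N"
    by blast
  have "\<exists>r. N = p ^ r"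
    using prime_power_if_linear_power_relation[OF z nz p(1), of N "eval_ac z frobenius_form_G"]
      nonclassical_line[OF FN 3 N] N q_gt_1 char by (cases "N = 0") auto
  then obtain r where r: "N = p ^ r"
    by blast
  have "N \<noteq> 1"
    using N q_gt_1 d by (intro notI) simp
  then have "r > 0"
    using r by (intro Nat.gr0I) simp
  moreover have "d * (p ^ r - 1) = q - 1"
    using N r d by (simp add: diff_mult_distrib2)
  ultimately show ?thesis
    using N r by blast
qed

text \<open>
  With \<open>d - 1 + q = d p\<^sup>r\<close>, the relation on the slices holds over every \<open>z\<close>. Its constant term
  gives an identity between values of polynomials in \<open>X\<^sub>0, X\<^sub>1, X\<^sub>2\<close> at all points, hence an identity of
  polynomials; its leading coefficient gives the condition on \<open>a\<^sub>i / a\<^sub>n\<close>.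
\<close>

lemma nonclassical_coefficients:
  assumes FN: "frobenius_nonclassical q n F" and N: "d - 1 + q = d * p ^ r"
  shows "frobenius_form_G = Const (of_nat d * a n) * (Const (1 / a n) * G) ^ (p ^ r)"
    and "i \<in> {3..n - 1} \<Longrightarrow> (a i / a n) ^ (p ^ r) = a i / a n"
proof -
  have nz: "to_ac (a n) \<noteq> 0" "of_nat d \<noteq> (0 :: 'k alg_closure)"
    using a n of_nat_d by (simp_all flip: to_ac_of_nat)
  have p': "CHAR('k alg_closure) = p"
    using char by simp
  note rel = frobenius_relation_coefficients[OF nz p(1) p' p(2) nonclassical_line[OF FN _ N]]
  have "frobenius_form_G - Const (of_nat d * a n) * (Const (1 / a n) * G) ^ (p ^ r) = 0"
  proof (rule eq_0_if_eval_ac_vanishing)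
    fix z
    show "eval_ac z (frobenius_form_G - Const (of_nat d * a n) * (Const (1 / a n) * G) ^ (p ^ r)) = 0"
      using rel(1)[of 3 z] n by (simp add: eval_ac_diff eval_ac_simps)
  qed
  then show "frobenius_form_G = Const (of_nat d * a n) * (Const (1 / a n) * G) ^ (p ^ r)"
    by simp
  show "(a i / a n) ^ (p ^ r) = a i / a n" if "i \<in> {3..n - 1}"
  proof -
    have "to_ac ((a i / a n) ^ (p ^ r)) = to_ac (a i / a n)"
      using rel(2)[OF that] by simp
    then show ?thesis by (simp only: to_ac_eq_iff)
  qed
qed

lemma frobenius_form_G_scaled:
  "(\<Sum>i\<le>2. partial_deriv i (Const c * G) * Var i ^ q) = Const c * frobenius_form_G"
  by (simp add: frobenius_form_G_def partial_deriv_Const_mult sum_distrib_left mult.assoc)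

lemma nonclassical_imp_decomposition:
  assumes FN: "frobenius_nonclassical q n F" and "G \<noteq> 0"
  shows "\<exists>r A. r > 0 \<and> d * (p ^ r - 1) = q - 1 \<and>
    (\<forall>i\<in>{..2}. vars (A i) \<subseteq> {..2} \<and> homogeneous ((d - 1) div p ^ r) (A i)) \<and>
    Const (1 / a n) * G = (\<Sum>i\<le>2. A i ^ (p ^ r) * Var i) \<and>
    Const (1 / a n) * G = (\<Sum>i\<le>2. A i * Var i ^ (q div p ^ r)) \<and>
    (\<forall>i\<in>{3..n - 1}. in_GF (p ^ r) (a i / a n))"
proof -
  obtain r where r: "r > 0" "d * (p ^ r - 1) = q - 1" "d - 1 + q = d * p ^ r"
    using nonclassical_degree[OF assms] by blast
  let ?g = "Const (1 / a n) * G"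
  have "a n \<noteq> 0" using a n by simp
  have "d - 1 < q"
  proof -
    have "p ^ r > 1" using r(1) by (rule prime_power_gt_1)
    then have "1 \<le> p ^ r - 1" by linarith
    then have "d \<le> d * (p ^ r - 1)"
      using mult_le_mono2[of 1 "p ^ r - 1" d] by simp
    then show ?thesis using r(2) q_gt_1 by linarith
  qed
  \<comment> \<open>the scaled form inherits degree and variables, as it has no new monomials\<close>
  have keys_g: "Poly_Mapping.keys ?g \<subseteq> Poly_Mapping.keys G"
    using keys_mult[of "Const (1 / a n)" G] by (auto simp: Const_def split: if_splits)
  have "homogeneous d ?g" "vars ?g \<subseteq> {..2}"
    using keys_g hom_G vars_G by (auto simp: homogeneous_def vars_def)
  moreover have "(\<Sum>i\<le>2. partial_deriv i ?g * Var i ^ q) = ?g ^ (p ^ r)"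
    unfolding frobenius_form_G_scaled nonclassical_coefficients(1)[OF FN r(3)] of_nat_d_eq_1[OF r(2,1)]
    using \<open>a n \<noteq> 0\<close> by (simp add: Const_1 flip: mult.assoc Const_mult)
  ultimately obtain A where A: "\<forall>i\<in>{..2}. vars (A i) \<subseteq> {..2} \<and> homogeneous ((d - 1) div p ^ r) (A i)"
      "?g = (\<Sum>i\<le>2. A i ^ (p ^ r) * Var i)" "?g = (\<Sum>i\<le>2. A i * Var i ^ (q div p ^ r))"
    using frobenius_decomposition[OF p(1) char q(2,1) exponent_le[OF r(2)], of d ?g "{..2}"]
      of_nat_d_eq_1[OF r(2,1)] \<open>d - 1 < q\<close> by blast
  have "card {x::'k. x ^ (p ^ r) = x} = p ^ r"
    using card_frobenius_fixed_points[OF q(2) r(2) prime_power_gt_1[OF r(1)]] d by simp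
  then have "in_GF (p ^ r) (a i / a n)" if "i \<in> {3..n - 1}" for i
    using in_GF_if_power_eq[OF p(1) char] nonclassical_coefficients(2)[OF FN r(3) that] by blast
  with r(1,2) A show ?thesis
    by blast
qed

text \<open>
  After division by \<open>a\<^sub>n\<close>, the polynomial \<open>\<Sum>\<^sub>i \<partial>F/\<partial>X\<^sub>i X\<^sub>i\<^sup>q\<close> is the \<open>p ^ r\<close>-th power of \<open>F\<close>: the part in
  \<open>X\<^sub>0, X\<^sub>1, X\<^sub>2\<close> is so by the decomposition, and the diagonal part because \<open>d - 1 + q = d p\<^sup>r\<close> and the
  \<open>a\<^sub>i / a\<^sub>n\<close> are fixed by the \<open>p ^ r\<close>-th power. In particular it vanishes wherever \<open>F\<close> does.
\<close>

lemma decomposition_imp_nonclassical: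
  assumes r: "r > 0" "d * (p ^ r - 1) = q - 1"
    and g: "Const (1 / a n) * G = (\<Sum>i\<le>2. A i ^ (p ^ r) * Var i)"
      "Const (1 / a n) * G = (\<Sum>i\<le>2. A i * Var i ^ (q div p ^ r))"
    and GF: "\<And>i. i \<in> {3..n - 1} \<Longrightarrow> in_GF (p ^ r) (a i / a n)"
  shows "frobenius_nonclassical q n F"
proof -
  let ?g = "Const (1 / a n) * G"
  have nz: "a n \<noteq> 0" using a n by simp
  have char': "prime CHAR('k alg_closure)" "p ^ r = CHAR('k alg_closure) ^ r"
    using p char by simp_all
  have "p ^ r dvd q"
    using exponent_le[OF r(2)] q(1) by (simp add: le_imp_power_dvd)
  then have "Const (1 / a n) * frobenius_form_G = ?g ^ (p ^ r)"
    using frobenius_form_if_decomposition[OF p(1) char r(1) _ _ g] by (simp add: frobenius_form_G_scaled)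
  then have form_G: "eval_ac x frobenius_form_G / to_ac (a n) = eval_ac x ?g ^ (p ^ r)" for x
    by (metis (no_types) eval_ac_mult eval_ac_power eval_ac_Const to_ac_divide to_ac_1
        times_divide_eq_left mult_1)
  have b: "(to_ac (a i) / to_ac (a n)) ^ (p ^ r) = to_ac (a i) / to_ac (a n)" if "i \<in> {3..n}" for i
  proof (cases "i = n")
    case False
    then have "(a i / a n) ^ (p ^ r) = a i / a n"
      using GF that in_GF_imp_power_eq by fastforce
    then show ?thesis by (simp flip: to_ac_divide to_ac_power)
  qed (use nz in simp)
  have exp: "d - 1 + q = d * p ^ r"
    using r degree_relation_iff by blast
  have "(\<Sum>i\<le>n. eval_ac x (partial_deriv i F) * x i ^ q) = 0" if "eval_ac x F = 0" for x
  proof -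
    have "of_nat d = (1 :: 'k alg_closure)"
      using of_nat_d_eq_1[OF r(2,1)] by (metis to_ac_1 to_ac_of_nat)
    then have "(\<Sum>i\<le>n. eval_ac x (partial_deriv i F) * x i ^ q) / to_ac (a n) =
        eval_ac x ?g ^ (p ^ r) + (\<Sum>i=3..n. to_ac (a i) / to_ac (a n) * x i ^ (d * p ^ r))"
      unfolding frobenius_form_eq exp by (simp add: add_divide_distrib form_G sum_divide_distrib)
    also have "(\<Sum>i=3..n. to_ac (a i) / to_ac (a n) * x i ^ (d * p ^ r)) =
        (\<Sum>i=3..n. (to_ac (a i) / to_ac (a n) * x i ^ d) ^ (p ^ r))"
      by (intro sum.cong refl) (simp only: power_mult_distrib b power_mult)
    also have "\<dots> = (\<Sum>i=3..n. to_ac (a i) / to_ac (a n) * x i ^ d) ^ (p ^ r)"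
      by (rule freshmans_dream_sum'[OF char', symmetric])
    also have "eval_ac x ?g ^ (p ^ r) + \<dots> =
        (eval_ac x ?g + (\<Sum>i=3..n. to_ac (a i) / to_ac (a n) * x i ^ d)) ^ (p ^ r)"
      by (rule freshmans_dream'[OF char', symmetric])
    also have "eval_ac x ?g + (\<Sum>i=3..n. to_ac (a i) / to_ac (a n) * x i ^ d) =
        eval_ac x F / to_ac (a n)"
      by (simp add: eval_ac_F eval_ac_simps add_divide_distrib sum_divide_distrib)
    finally show ?thesis
      using that nz p(1) by (simp add: power_0_left)
  qed
  then show ?thesis
    using frobenius_nonclassical_iff[of q n F] q_gt_1 by simp
qed

text \<open>
  If \<open>G\<close> were zero, then \<open>(1 : 0 : \<dots> : 0)\<close> would be a singular point of the hypersurface, since \<open>d > 1\<close>.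
\<close>

lemma G_nonzero:
  assumes reg: "hypersurface n F \<inter> (\<Inter>i\<in>{3..n}. coord_hyperplane n i) \<subseteq> regular_locus n F"
  shows "G \<noteq> 0"
proof
  assume "G = 0"
  define x :: "nat \<Rightarrow> 'k alg_closure" where "x = (\<lambda>i. if i = 0 then 1 else 0)"
  have "x \<in> proj_space n"
    by (auto simp: x_def proj_space_def)
  moreover have "eval_ac x F = 0"
    using d \<open>G = 0\<close> by (auto simp: eval_ac_F eval_ac_0 x_def intro!: sum.neutral)
  ultimately have "x \<in> hypersurface n F \<inter> (\<Inter>i\<in>{3..n}. coord_hyperplane n i)"
    by (auto simp: hypersurface_def coord_hyperplane_def eval_ac_def) (simp add: x_def)
  with reg have "x \<in> regular_locus n F"
    by blast
  then obtain i where i: "i \<le> n" "eval_ac x (partial_deriv i F) \<noteq> 0"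
    by (auto simp: regular_locus_def eval_ac_def partial_deriv_base_change)
  show False
  proof (cases "i \<le> 2")
    case True
    then show ?thesis
      using i \<open>G = 0\<close> by (simp add: partial_deriv_F_ternary partial_deriv_0 eval_ac_0)
  next
    case False
    then show ?thesis
      using i d by (simp add: partial_deriv_F_diagonal eval_ac_simps x_def)
  qed
qed

end


section \<open>Characterization of Frobenius nonclassical hypersurfaces\<close>

theorem theorem4p6:
  fixes p s q n d :: nat
    and a :: "nat \<Rightarrow> 'k::finite_field"
    and F G :: "'k mpoly"
  assumes "prime p" and "p > 3" and "q = p ^ s" and "card (UNIV :: 'k set) = q"
    and "n > 3" and "d > 2"
    and "F = G + (\<Sum>i=3..n. Const (a i) * Var i ^ d)"
    and "vars G \<subseteq> {..2}"
    and "homogeneous d F"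
    and "\<And>i. i \<in> {3..n} \<Longrightarrow> a i \<noteq> 0"
    and "abs_irreducible F"
    and "\<not> p dvd d"
    and "(\<Sum>i\<le>n. partial_deriv i F * Var i ^ q) \<noteq> 0"
    and "hypersurface n F \<inter> (\<Inter>i\<in>{3..n}. coord_hyperplane n i) \<subseteq> regular_locus n F"
  shows "frobenius_nonclassical q n F \<longleftrightarrow>
    (\<exists>(r::nat) (A::'k mpoly) (B::'k mpoly) (C::'k mpoly).
        r > 0 \<and>
        real d = (real q - 1) / (real p ^ r - 1) \<and>
        vars A \<subseteq> {..2} \<and> homogeneous ((d - 1) div p ^ r) A \<and>
        vars B \<subseteq> {..2} \<and> homogeneous ((d - 1) div p ^ r) B \<and>
        vars C \<subseteq> {..2} \<and> homogeneous ((d - 1) div p ^ r) C \<and>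
        Const (1 / a n) * G = A ^ (p ^ r) * Var 0 + B ^ (p ^ r) * Var 1 + C ^ (p ^ r) * Var 2 \<and>
        Const (1 / a n) * G =
          A * Var 0 ^ (q div p ^ r) + B * Var 1 ^ (q div p ^ r) + C * Var 2 ^ (q div p ^ r) \<and>
        (\<forall>i\<in>{3..n - 1}. in_GF (p ^ r) (a i / a n)))"
proof -
  interpret ternary_plus_diagonal p s q n d a F G
    using assms by unfold_locales auto
  have degree_iff: "real d = (real q - 1) / (real p ^ r - 1) \<longleftrightarrow> d * (p ^ r - 1) = q - 1"
    if "r > 0" for r
  proof -
    have "p ^ r > 1"
      using that by (rule prime_power_gt_1)
    then have "real p ^ r > 1"
      by (metis of_nat_1 of_nat_less_iff of_nat_power)
    then have "real d = (real q - 1) / (real p ^ r - 1) \<longleftrightarrow> real d * (real p ^ r - 1) = real q - 1"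
      by (simp add: eq_divide_eq)
    also have "\<dots> \<longleftrightarrow> real (d * (p ^ r - 1)) = real (q - 1)"
      using \<open>p ^ r > 1\<close> q_gt_1 by (simp add: of_nat_diff)
    finally show ?thesis
      by (simp only: of_nat_eq_iff)
  qed
  have sum3: "(\<Sum>i\<le>2. f i) = f 0 + f 1 + f 2" for f :: "nat \<Rightarrow> 'k mpoly"
    by (simp add: numeral_2_eq_2)
  show ?thesis
  proof (intro iffI; (elim exE conjE)?)
    assume "frobenius_nonclassical q n F"
    then obtain r A where "r > 0" "d * (p ^ r - 1) = q - 1"
        "\<forall>i\<in>{..2}. vars (A i) \<subseteq> {..2} \<and> homogeneous ((d - 1) div p ^ r) (A i)"
        "Const (1 / a n) * G = (\<Sum>i\<le>2. A i ^ (p ^ r) * Var i)"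
        "Const (1 / a n) * G = (\<Sum>i\<le>2. A i * Var i ^ (q div p ^ r))"
        "\<forall>i\<in>{3..n - 1}. in_GF (p ^ r) (a i / a n)"
      using nonclassical_imp_decomposition G_nonzero[OF assms(14)] by blast
    then show "\<exists>r A B C. r > 0 \<and>
        real d = (real q - 1) / (real p ^ r - 1) \<and>
        vars A \<subseteq> {..2} \<and> homogeneous ((d - 1) div p ^ r) A \<and>
        vars B \<subseteq> {..2} \<and> homogeneous ((d - 1) div p ^ r) B \<and>
        vars C \<subseteq> {..2} \<and> homogeneous ((d - 1) div p ^ r) C \<and>
        Const (1 / a n) * G = A ^ (p ^ r) * Var 0 + B ^ (p ^ r) * Var 1 + C ^ (p ^ r) * Var 2 \<and>
        Const (1 / a n) * G =
          A * Var 0 ^ (q div p ^ r) + B * Var 1 ^ (q div p ^ r) + C * Var 2 ^ (q div p ^ r) \<and>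
        (\<forall>i\<in>{3..n - 1}. in_GF (p ^ r) (a i / a n))"
      unfolding sum3
      by (intro exI[of _ r] exI[of _ "A 0"] exI[of _ "A 1"] exI[of _ "A 2"]) (simp add: degree_iff)
  next
    fix r A B C
    assume r: "r > 0" "real d = (real q - 1) / (real p ^ r - 1)"
      and g: "Const (1 / a n) * G = A ^ (p ^ r) * Var 0 + B ^ (p ^ r) * Var 1 + C ^ (p ^ r) * Var 2"
        "Const (1 / a n) * G =
          A * Var 0 ^ (q div p ^ r) + B * Var 1 ^ (q div p ^ r) + C * Var 2 ^ (q div p ^ r)"
      and GF: "\<forall>i\<in>{3..n - 1}. in_GF (p ^ r) (a i / a n)"
    define A' where "A' = (\<lambda>i::nat. if i = 0 then A else if i = 1 then B else C)"
    show "frobenius_nonclassical q n F"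
    proof (rule decomposition_imp_nonclassical)
      show "d * (p ^ r - 1) = q - 1"
        using r degree_iff by simp
      show "Const (1 / a n) * G = (\<Sum>i\<le>2. A' i ^ (p ^ r) * Var i)"
        unfolding sum3 g(1) by (simp add: A'_def)
      show "Const (1 / a n) * G = (\<Sum>i\<le>2. A' i * Var i ^ (q div p ^ r))"
        unfolding sum3 g(2) by (simp add: A'_def)
    qed (use r GF in auto)
  qed
qed

end
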